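(* Consider the fully-distributed gossip network described in the context, with $n$ nodes, source self-update rate $\lambda_e>0$, source-to-network update rate $\lambda>0$, gossip duration $\delta>0$, and total gossip capacity $B=n\lambda$. Then, with $\lambda_e,\lambda,\delta$ fixed, the steady-state mean version age $a_i=\lim_{t\to\infty}\mathbb{E}[\Delta_i(t)]$ of any node $i$ scales as $O(1)$ as $n\to\infty$.
   Context: A source (node $0$) and nodes $\mathcal{N}=\{1,\dots,n\}$ form a fully connected network. The source generates new versions according to a Poisson process of rate $\lambda_e$; $N_s(t)$ is the source's version and $N_i(t)$ node $i$'s version. The source sends its current version to each node according to an independent Poisson process of rate $\lambda/n$. The version age of node $i$ is $\Delta_i(t)=N_s(t)-N_i(t)$: a source self-update increases every $\Delta_i$ by $1$; a source-to-node-$i$ update sets $\Delta_i$ to $0$; when node $j$ successfully gossips to node $i$, node $i$'s age becomes $\min\{\Delta_j(t),\Delta_i(t)\}$. Fully-distributed scheme: whenever a node receives an update from the source, it gossips with total rate $B$ (i.e., sends gossip updates to each of its $n-1$ neighbors according to a Poisson process of rate $B/(n-1)$) for a fixed time duration $\delta$ and then stops. If at some time more than one node is gossiping, the total instantaneous rate exceeds $B$ and interference occurs, so no gossip update is delivered; gossip updates are delivered only while exactly one node is gossiping. The steady-state mean age is $a_i=\lim_{t\to\infty}\mathbb{E}[\Delta_i(t)]$. *)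

theory Defs
  imports "HOL-Probability.Probability"
begin

text \<open>Fully-distributed gossip network with n nodes.  Every Poisson process of the
model is given by its i.i.d. exponential interarrival times.  The processes are:
  Gen        : version generation at the source (rate lambda_e),
  Src i      : source-to-node-i updates (rate lambda/n),
  Gsp j i    : (background) gossip clock of node j towards node i (rate B/(n-1));
               a tick of Gsp j i is a gossip transmission from j to i only while
               j is gossiping, and it is delivered only if j is the unique
               gossiping node (interference otherwise).\<close>

datatype proc = Gen | Src nat | Gsp nat nat

definition procs :: "nat \<Rightarrow> proc set" where
  "procs n = {Gen} \<union> Src ` {1..n} \<union> {Gsp j i | j i. j \<in> {1..n} \<and> i \<in> {1..n} \<and> j \<noteq> i}"

definition rate :: "nat \<Rightarrow> real \<Rightarrow> real \<Rightarrow> real \<Rightarrow> proc \<Rightarrow> real" where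
  "rate n lam_e lam B k = (case k of
      Gen \<Rightarrow> lam_e
    | Src i \<Rightarrow> lam / real n
    | Gsp j i \<Rightarrow> B / (real n - 1))"

definition arr :: "(nat \<Rightarrow> real) \<Rightarrow> nat \<Rightarrow> real" where
  "arr X m = (\<Sum>l\<le>m. X l)"

definition src_ver :: "(proc \<Rightarrow> nat \<Rightarrow> real) \<Rightarrow> real \<Rightarrow> nat" where
  "src_ver X t = card {m. arr (X Gen) m \<le> t}"

definition gossiping :: "(proc \<Rightarrow> nat \<Rightarrow> real) \<Rightarrow> real \<Rightarrow> nat \<Rightarrow> real \<Rightarrow> bool" where
  "gossiping X delta j s \<longleftrightarrow> (\<exists>m. arr (X (Src j)) m \<le> s \<and> s < arr (X (Src j)) m + delta)"

definition delivered :: "nat \<Rightarrow> (proc \<Rightarrow> nat \<Rightarrow> real) \<Rightarrow> real \<Rightarrow> nat \<Rightarrow> real \<Rightarrow> bool" where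
  "delivered n X delta j s \<longleftrightarrow> gossiping X delta j s \<and>
      (\<forall>j'\<in>{1..n}. j' \<noteq> j \<longrightarrow> \<not> gossiping X delta j' s)"

inductive has_ver :: "nat \<Rightarrow> (proc \<Rightarrow> nat \<Rightarrow> real) \<Rightarrow> real \<Rightarrow> nat \<Rightarrow> real \<Rightarrow> nat \<Rightarrow> bool"
  for n X delta where
  init: "has_ver n X delta i t 0"
| from_src: "\<lbrakk> i \<in> {1..n}; arr (X (Src i)) m \<le> t \<rbrakk> \<Longrightarrow>
     has_ver n X delta i t (src_ver X (arr (X (Src i)) m))"
| from_gossip: "\<lbrakk> i \<in> {1..n}; j \<in> {1..n}; j \<noteq> i; has_ver n X delta j s v;
     s < arr (X (Gsp j i)) m; arr (X (Gsp j i)) m \<le> t;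
     delivered n X delta j (arr (X (Gsp j i)) m) \<rbrakk> \<Longrightarrow> has_ver n X delta i t v"

definition node_ver :: "nat \<Rightarrow> (proc \<Rightarrow> nat \<Rightarrow> real) \<Rightarrow> real \<Rightarrow> nat \<Rightarrow> real \<Rightarrow> nat" where
  "node_ver n X delta i t = (GREATEST v. has_ver n X delta i t v)"

definition age :: "nat \<Rightarrow> (proc \<Rightarrow> nat \<Rightarrow> real) \<Rightarrow> real \<Rightarrow> nat \<Rightarrow> real \<Rightarrow> real" where
  "age n X delta i t = real (src_ver X t) - real (node_ver n X delta i t)"

definition gossip_model ::
  "'a measure \<Rightarrow> nat \<Rightarrow> real \<Rightarrow> real \<Rightarrow> real \<Rightarrow> (proc \<Rightarrow> nat \<Rightarrow> 'a \<Rightarrow> real) \<Rightarrow> bool" where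
  "gossip_model M n lam_e lam B X \<longleftrightarrow>
     prob_space.indep_vars M (\<lambda>_. borel) (\<lambda>(k, m). X k m) (procs n \<times> UNIV) \<and>
     (\<forall>k\<in>procs n. \<forall>m. distributed M lborel (X k m) (exponential_density (rate n lam_e lam B k)))"

end

theory Submission
  imports Defs "HOL-Real_Asymp.Real_Asymp"
begin

text \<open>
  Write N for the version counter of the source. For \<open>a \<ge> \<delta>\<close> the truncated age
  \<open>min (\<Delta>\<^sub>i(t)) (N(t) - N(a))\<close> is a function of the Poisson points after time \<open>a - \<delta>\<close>, since an
  update is relevant only if it left the source after \<open>a\<close>, and from then on the set of gossiping nodes is
  determined by the source contacts of the last \<open>\<delta>\<close> time units. Restarting all Poisson processes at a
  fixed time therefore shows that its mean depends only on \<open>t - a\<close>; it increases with \<open>t - a\<close>.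

  Cut time into windows of length \<open>2\<delta>\<close>. In a window, independently of the past and with some probability
  \<open>p\<close>, the source contacts exactly one node j at a moment at which nobody else gossips, and j then delivers
  to i; this resets the age of i to at most the number of versions generated since the start of the window.
  Replacing the truncation point by an earlier one at distance at most \<open>2\<delta>\<close> thus changes the mean by at most
  the mean number of versions per window times \<open>(1 - p) ^ l\<close>, where l is the number of complete windows
  between the later of the two points and t. Summing the geometric series bounds the truncated means by the
  mean number of versions per window divided by \<open>p\<close>, and the truncation at \<open>\<delta>\<close> is asymptotically
  negligible. For \<open>B = n \<lambda>\<close> the probability \<open>p\<close> is bounded below uniformly in n: each single node is
  contacted with a probability of order \<open>1 / n\<close>, but there are \<open>n - 1\<close> candidates for j.
\<close>

section \<open>Preliminaries\<close>

lemma exp_minus_diff_ge: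
  fixes x y :: real
  shows "(y - x) * exp (- y) \<le> exp (- x) - exp (- y)"
proof -
  have "(1 + (y - x)) * exp (- y) \<le> exp (y - x) * exp (- y)"
    by (intro mult_right_mono exp_ge_add_one_self) simp
  then show ?thesis by (simp add: algebra_simps flip: exp_add)
qed

lemma measurable_Greatest_nat:
  fixes P :: "nat \<Rightarrow> 'a \<Rightarrow> bool"
  assumes [measurable]: "\<And>v. Measurable.pred M (P v)"
  shows "(\<lambda>x. GREATEST v. P v x) \<in> measurable M (count_space UNIV)"
  unfolding Greatest_def
  by (rule measurable_THE[where I = UNIV]) (auto intro: antisym)

lemma mono_on_tendsto_SUP_at_top:
  fixes f :: "'a::linorder \<Rightarrow> 'b::{complete_linorder, linorder_topology}"
  assumes "mono_on {a..} f"
  shows "(f \<longlongrightarrow> (SUP x\<in>{a..}. f x)) at_top"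
proof (rule order_tendstoI)
  fix u assume "u < (SUP x\<in>{a..}. f x)"
  then obtain y where f_y_gt: "a \<le> y" "u < f y"
    by (auto simp: less_SUP_iff)
  show "\<forall>\<^sub>F x in at_top. u < f x"
    using eventually_ge_at_top[of y]
  proof eventually_elim
    case (elim x)
    with f_y_gt have "f y \<le> f x" by (intro mono_onD[OF assms]) auto
    with f_y_gt show ?case by simp
  qed
next
  fix u assume SUP_less: "(SUP x\<in>{a..}. f x) < u"
  show "\<forall>\<^sub>F x in at_top. f x < u"
    using eventually_ge_at_top[of a]
  proof eventually_elim
    case (elim x)
    then have "f x \<le> (SUP x\<in>{a..}. f x)" by (intro SUP_upper) auto
    with SUP_less show ?case by simp
  qed
qed

lemma (in product_prob_space) nn_integral_component_mult:
  assumes I_props: "finite I" "k \<in> I"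
    and f_meas [measurable]: "f \<in> borel_measurable (M k)"
    and g_meas [measurable]: "g \<in> borel_measurable (PiM I M)"
    and g_upd: "\<And>x z. g (x(k := z)) = g x"
  shows "(\<integral>\<^sup>+x. f (x k) * g x \<partial>PiM I M) = (\<integral>\<^sup>+z. f z \<partial>M k) * (\<integral>\<^sup>+x. g x \<partial>PiM I M)"
proof -
  define J where "J = I - {k}"
  have J_props: "finite J" "k \<notin> J" and I_eq: "I = insert k J"
    using I_props by (auto simp: J_def)
  have [measurable]: "g \<in> borel_measurable (PiM (insert k J) M)"
    using g_meas unfolding I_eq .
  define c where "c = (\<integral>\<^sup>+x. g x \<partial>PiM J M)"
  have split: "(\<integral>\<^sup>+x. h (x k) * g x \<partial>PiM I M) = (\<integral>\<^sup>+z. h z \<partial>M k) * c"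
    if [measurable]: "h \<in> borel_measurable (M k)" for h
  proof -
    have "(\<integral>\<^sup>+x. h (x k) * g x \<partial>PiM I M) = (\<integral>\<^sup>+z. \<integral>\<^sup>+x. h z * g (x(k := z)) \<partial>PiM J M \<partial>M k)"
      unfolding I_eq by (subst product_nn_integral_insert_rev[OF J_props]) auto
    also have "\<dots> = (\<integral>\<^sup>+z. h z * c \<partial>M k)"
    proof (rule nn_integral_cong)
      fix z assume "z \<in> space (M k)"
      then have "(\<lambda>x. x(k := z)) \<in> PiM J M \<rightarrow>\<^sub>M PiM (insert k J) M"
        by (intro measurable_fun_upd[where J = J]) auto
      then have "(\<lambda>x. g (x(k := z))) \<in> borel_measurable (PiM J M)"
        by (rule measurable_compose) fact
      then have "(\<integral>\<^sup>+x. h z * g (x(k := z)) \<partial>PiM J M) = h z * (\<integral>\<^sup>+x. g (x(k := z)) \<partial>PiM J M)"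
        by (rule nn_integral_cmult)
      then show "(\<integral>\<^sup>+x. h z * g (x(k := z)) \<partial>PiM J M) = h z * c"
        unfolding c_def g_upd .
    qed
    also have "\<dots> = (\<integral>\<^sup>+z. h z \<partial>M k) * c"
      by (rule nn_integral_multc) measurable
    finally show ?thesis .
  qed
  from split[of "\<lambda>_. 1"] have "(\<integral>\<^sup>+x. g x \<partial>PiM I M) = c"
    by (simp add: M.emeasure_space_1)
  with split[OF f_meas] show ?thesis by simp
qed

lemma Int_stable_vimage:
  assumes "Int_stable \<G>"
  shows "Int_stable {f -` A \<inter> \<Omega> | A. A \<in> \<G>}"
proof (rule Int_stableI)
  fix a b assume "a \<in> {f -` A \<inter> \<Omega> | A. A \<in> \<G>}" "b \<in> {f -` A \<inter> \<Omega> | A. A \<in> \<G>}"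
  then obtain A B where "A \<in> \<G>" "B \<in> \<G>" "a = f -` A \<inter> \<Omega>" "b = f -` B \<inter> \<Omega>" by auto
  then show "a \<inter> b \<in> {f -` A \<inter> \<Omega> | A. A \<in> \<G>}"
    using Int_stableD[OF assms] by (intro CollectI exI[of _ "A \<inter> B"]) auto
qed

lemma vimage_in_sigma_sets:
  assumes f_meas: "f \<in> M \<rightarrow>\<^sub>M N" and sets_N: "sets N = sigma_sets \<Omega> \<G>" "\<G> \<subseteq> Pow \<Omega>"
    and A_sets: "A \<in> sets N"
  shows "f -` A \<inter> space M \<in> sigma_sets (space M) {f -` B \<inter> space M | B. B \<in> \<G>}"
proof -
  have "space N = \<Omega>"
    using sigma_sets_into_sp[OF sets_N(2), of "space N"] sigma_sets_top[of \<Omega> \<G>]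
      sets.sets_into_space[of \<Omega> N]
    unfolding sets_N(1)[symmetric] by auto
  then have "f \<in> space M \<rightarrow> \<Omega>" using measurable_space[OF f_meas] by auto
  from sigma_sets_vimage_commute[OF this, of \<G>] A_sets show ?thesis
    unfolding sets_N(1) by blast
qed

lemma (in prob_space) prob_vimage_Int_generators:
  assumes X_meas: "random_variable S X" and Y_meas: "random_variable T Y"
    and sets_S: "sets S = sigma_sets \<Omega>\<^sub>S \<A>" "\<A> \<subseteq> Pow \<Omega>\<^sub>S" "Int_stable \<A>"
    and sets_T: "sets T = sigma_sets \<Omega>\<^sub>T \<B>" "\<B> \<subseteq> Pow \<Omega>\<^sub>T" "Int_stable \<B>"
    and generators: "\<And>A B. A \<in> \<A> \<Longrightarrow> B \<in> \<B> \<Longrightarrow> prob ((X -` A \<inter> space M) \<inter> (Y -` B \<inter> space M)) =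
      prob (X -` A \<inter> space M) * prob (Y -` B \<inter> space M)"
    and A_sets: "A \<in> sets S" and B_sets: "B \<in> sets T"
  shows "prob ((X -` A \<inter> space M) \<inter> (Y -` B \<inter> space M)) =
    prob (X -` A \<inter> space M) * prob (Y -` B \<inter> space M)"
proof -
  have "{X -` A \<inter> space M | A. A \<in> \<A>} \<subseteq> events" "{Y -` B \<inter> space M | B. B \<in> \<B>} \<subseteq> events"
    using measurable_sets[OF X_meas] measurable_sets[OF Y_meas] sets_S(1) sets_T(1) by auto
  then have "indep_set {X -` A \<inter> space M | A. A \<in> \<A>} {Y -` B \<inter> space M | B. B \<in> \<B>}"
    unfolding indep_sets2_eq using generators by blast
  then have "indep_set (sigma_sets (space M) {X -` A \<inter> space M | A. A \<in> \<A>})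
      (sigma_sets (space M) {Y -` B \<inter> space M | B. B \<in> \<B>})"
    by (intro indep_set_sigma_sets Int_stable_vimage sets_S(3) sets_T(3))
  then show ?thesis
    using vimage_in_sigma_sets[OF X_meas sets_S(1,2) A_sets]
      vimage_in_sigma_sets[OF Y_meas sets_T(1,2) B_sets]
    by (rule indep_setD)
qed

lemma (in product_prob_space) measure_PiM:
  assumes "finite I" "\<And>k. k \<in> I \<Longrightarrow> A k \<in> sets (M k)"
  shows "measure (PiM I M) (PiE I A) = (\<Prod>k\<in>I. measure (M k) (A k))"
  using emeasure_PiM[OF assms] unfolding P.emeasure_eq_measure M.emeasure_eq_measure
  by (simp add: prod_ennreal measure_nonneg prod_nonneg)

lemma (in product_prob_space) prob_PiM_coordinatewise_indep:
  assumes finite_I: "finite I"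
    and f_meas: "\<And>k. k \<in> I \<Longrightarrow> f k \<in> M k \<rightarrow>\<^sub>M S k" and g_meas: "\<And>k. k \<in> I \<Longrightarrow> g k \<in> M k \<rightarrow>\<^sub>M T k"
    and indep: "\<And>k A B. k \<in> I \<Longrightarrow> A \<in> sets (S k) \<Longrightarrow> B \<in> sets (T k) \<Longrightarrow>
      measure (M k) {z \<in> space (M k). f k z \<in> A \<and> g k z \<in> B} =
      measure (M k) {z \<in> space (M k). f k z \<in> A} * measure (M k) {z \<in> space (M k). g k z \<in> B}"
    and E_sets: "E \<in> sets (PiM I S)" and H_sets: "H \<in> sets (PiM I T)"
  shows "\<P>(x in PiM I M. (\<lambda>k\<in>I. f k (x k)) \<in> E \<and> (\<lambda>k\<in>I. g k (x k)) \<in> H) =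
    \<P>(x in PiM I M. (\<lambda>k\<in>I. f k (x k)) \<in> E) * \<P>(x in PiM I M. (\<lambda>k\<in>I. g k (x k)) \<in> H)"
proof -
  let ?F = "\<lambda>x. \<lambda>k\<in>I. f k (x k)" and ?G = "\<lambda>x. \<lambda>k\<in>I. g k (x k)" and ?\<Omega> = "space (PiM I M)"
  have F_meas: "?F \<in> PiM I M \<rightarrow>\<^sub>M PiM I S" and G_meas: "?G \<in> PiM I M \<rightarrow>\<^sub>M PiM I T"
    by (auto intro!: measurable_restrict measurable_compose[OF measurable_component_singleton]
        f_meas g_meas)
  have boxes: "P.prob ((?F -` E \<inter> ?\<Omega>) \<inter> (?G -` H \<inter> ?\<Omega>)) =
      P.prob (?F -` E \<inter> ?\<Omega>) * P.prob (?G -` H \<inter> ?\<Omega>)"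
    if E_sets: "E \<in> prod_algebra I S" and H_sets: "H \<in> prod_algebra I T" for E H
  proof -
    obtain A B where E_eq: "E = PiE I A" "\<And>k. k \<in> I \<Longrightarrow> A k \<in> sets (S k)"
      and H_eq: "H = PiE I B" "\<And>k. k \<in> I \<Longrightarrow> B k \<in> sets (T k)"
      using E_sets H_sets unfolding prod_algebra_eq_finite[OF finite_I] by blast
    have "?F -` E \<inter> ?\<Omega> = PiE I (\<lambda>k. {z \<in> space (M k). f k z \<in> A k})"
      "?G -` H \<inter> ?\<Omega> = PiE I (\<lambda>k. {z \<in> space (M k). g k z \<in> B k})"
      "(?F -` E \<inter> ?\<Omega>) \<inter> (?G -` H \<inter> ?\<Omega>) = PiE I (\<lambda>k. {z \<in> space (M k). f k z \<in> A k \<and> g k z \<in> B k})"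
      by (auto simp: E_eq(1) H_eq(1) space_PiM PiE_iff)
    moreover note [measurable] = f_meas g_meas E_eq(2) H_eq(2)
    ultimately show ?thesis
      by (simp only:) (simp add: measure_PiM finite_I indep E_eq(2) H_eq(2) prod.distrib)
  qed
  have "P.prob ((?F -` E \<inter> ?\<Omega>) \<inter> (?G -` H \<inter> ?\<Omega>)) = P.prob (?F -` E \<inter> ?\<Omega>) * P.prob (?G -` H \<inter> ?\<Omega>)"
    by (rule P.prob_vimage_Int_generators[OF F_meas G_meas
        sets_PiM prod_algebra_sets_into_space Int_stable_prod_algebra
        sets_PiM prod_algebra_sets_into_space Int_stable_prod_algebra boxes E_sets H_sets])
  moreover have "(?F -` E \<inter> ?\<Omega>) \<inter> (?G -` H \<inter> ?\<Omega>) = {x \<in> ?\<Omega>. ?F x \<in> E \<and> ?G x \<in> H}"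
    "?F -` E \<inter> ?\<Omega> = {x \<in> ?\<Omega>. ?F x \<in> E}" "?G -` H \<inter> ?\<Omega> = {x \<in> ?\<Omega>. ?G x \<in> H}" by auto
  ultimately show ?thesis by simp
qed

lemma (in prob_space) indep_vars_section:
  assumes indep: "indep_vars (\<lambda>_. N) (\<lambda>(k, m). X k m) (I \<times> J)" and k_mem: "k \<in> I"
  shows "indep_vars (\<lambda>_. N) (X k) J"
proof -
  have "indep_vars (\<lambda>m. PiM {(k, m)} (\<lambda>_. N)) (\<lambda>m \<omega>. \<lambda>p\<in>{(k, m)}. (case p of (k, m) \<Rightarrow> X k m) \<omega>) J"
    using k_mem by (intro indep_vars_restrict[OF indep]) (auto simp: disjoint_family_on_def)
  then have "indep_vars (\<lambda>_. N)
      (\<lambda>m \<omega>. (\<lambda>f. f (k, m)) (\<lambda>p\<in>{(k, m)}. (case p of (k, m) \<Rightarrow> X k m) \<omega>)) J"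
    by (rule indep_vars_compose2) (rule measurable_component_singleton, simp)
  then show ?thesis by simp
qed

lemma (in prob_space) indep_vars_sequences:
  assumes indep: "indep_vars (\<lambda>_. N) (\<lambda>(k, m). X k m) (I \<times> UNIV)"
  shows "indep_vars (\<lambda>_. PiM UNIV (\<lambda>_. N)) (\<lambda>k \<omega> m. X k m \<omega>) I"
proof -
  have "indep_vars (\<lambda>k. PiM ({k} \<times> UNIV) (\<lambda>_. N))
      (\<lambda>k \<omega>. \<lambda>p\<in>{k} \<times> UNIV. (case p of (k, m) \<Rightarrow> X k m) \<omega>) I"
    by (intro indep_vars_restrict[OF indep]) (auto simp: disjoint_family_on_def)
  then have "indep_vars (\<lambda>_. PiM UNIV (\<lambda>_. N))
      (\<lambda>k \<omega>. (\<lambda>f m. f (k, m)) (\<lambda>p\<in>{k} \<times> UNIV. (case p of (k, m) \<Rightarrow> X k m) \<omega>)) I"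
  proof (rule indep_vars_compose2)
    fix k
    show "(\<lambda>f m. f (k, m)) \<in> PiM ({k} \<times> UNIV) (\<lambda>_. N) \<rightarrow>\<^sub>M PiM UNIV (\<lambda>_. N)"
      by (rule measurable_PiM_single') (auto simp: space_PiM intro!: measurable_component_singleton)
  qed
  then show ?thesis by simp
qed

section \<open>Arrival times\<close>

definition arrivals_upto :: "(nat \<Rightarrow> real) \<Rightarrow> real \<Rightarrow> nat" where
  "arrivals_upto z t = card {m. arr z m \<le> t}"

definition arrival_times :: "(nat \<Rightarrow> real) \<Rightarrow> real set" where
  "arrival_times z = range (arr z)"

definition regular :: "(nat \<Rightarrow> real) \<Rightarrow> bool" where
  "regular z \<longleftrightarrow> (\<forall>m. 0 < z m) \<and> (\<forall>t. \<exists>m. t < arr z m)"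

text \<open>Interarrival times of the process restarted at time \<open>s\<close>. The values are
  meaningless for sequences that are not regular, where \<open>arrivals_upto\<close>
  may be the cardinality \<open>0\<close> of an infinite set.\<close>

definition residual :: "real \<Rightarrow> (nat \<Rightarrow> real) \<Rightarrow> nat \<Rightarrow> real" where
  "residual s z k = (if k = 0 then arr z (arrivals_upto z s) - s else z (arrivals_upto z s + k))"

lemma arr_0: "arr z 0 = z 0"
  by (simp add: arr_def)

lemma arr_Suc: "arr z (Suc m) = arr z m + z (Suc m)"
  by (simp add: arr_def)

lemma arr_case_nat_0: "arr (case_nat a z) 0 = a"
  by (simp add: arr_0)

lemma arr_case_nat_Suc: "arr (case_nat a z) (Suc m) = a + arr z m"
  by (induction m) (simp_all add: arr_0 arr_Suc)

lemma strict_mono_arr: "regular z \<Longrightarrow> strict_mono (arr z)"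
  by (intro strict_monoI_Suc) (simp add: arr_Suc regular_def)

lemma arr_pos: "regular z \<Longrightarrow> 0 < arr z m"
  by (induction m) (auto simp: arr_0 arr_Suc regular_def add_pos_pos)

lemma less_arrivals_upto_iff:
  assumes "regular z"
  shows "m < arrivals_upto z t \<longleftrightarrow> arr z m \<le> t"
proof -
  define k where "k = (LEAST m. t < arr z m)"
  have arr_k_gt: "t < arr z k"
    unfolding k_def by (rule LeastI_ex) (use assms in \<open>auto simp: regular_def\<close>)
  have "arr z m \<le> t \<longleftrightarrow> m < k" for m
  proof
    assume "arr z m \<le> t"
    with arr_k_gt have "arr z m < arr z k" by simp
    then show "m < k" using strict_mono_arr[OF assms] by (simp add: strict_mono_less)
  next
    assume "m < k"
    then show "arr z m \<le> t"
      using not_less_Least[of m "\<lambda>m. t < arr z m"] by (simp add: k_def not_less)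
  qed
  then show ?thesis by (simp add: arrivals_upto_def)
qed

lemma arrivals_upto_mono:
  assumes "regular z" "s \<le> t"
  shows "arrivals_upto z s \<le> arrivals_upto z t"
proof (rule ccontr)
  assume "\<not> ?thesis"
  then have "arr z (arrivals_upto z t) \<le> t"
    using assms(2) by (simp add: not_le less_arrivals_upto_iff[OF assms(1)])
  then show False by (simp flip: less_arrivals_upto_iff[OF assms(1)])
qed

lemma arrivals_upto_0: "regular z \<Longrightarrow> arrivals_upto z 0 = 0"
  using less_arrivals_upto_iff[of z 0 0] arr_pos[of z 0] by auto

lemma arrivals_upto_diff_eq_card:
  assumes reg: "regular z"
  shows "arrivals_upto z t - arrivals_upto z s = card (arrival_times z \<inter> {s<..t})"
proof -
  have "arrival_times z \<inter> {s<..t} = arr z ` {arrivals_upto z s..<arrivals_upto z t}"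
    by (auto simp: arrival_times_def less_arrivals_upto_iff[OF reg] not_le simp flip: not_less)
  then show ?thesis
    using strict_mono_arr[OF reg]
    by (simp add: card_image strict_mono_imp_inj_on inj_on_subset[OF _ subset_UNIV])
qed

lemma arr_residual: "arr (residual s z) k = arr z (arrivals_upto z s + k) - s"
  by (induction k) (simp_all add: arr_0 arr_Suc residual_def)

lemma arrival_times_residual:
  assumes reg: "regular z"
  shows "u \<in> arrival_times (residual s z) \<longleftrightarrow> 0 < u \<and> u + s \<in> arrival_times z"
proof
  assume "u \<in> arrival_times (residual s z)"
  then obtain k where "u + s = arr z (arrivals_upto z s + k)"
    by (auto simp: arrival_times_def arr_residual)
  moreover have "s < arr z (arrivals_upto z s + k)"
    using less_arrivals_upto_iff[OF reg, of "arrivals_upto z s + k" s] by auto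
  ultimately show "0 < u \<and> u + s \<in> arrival_times z" by (simp add: arrival_times_def)
next
  assume "0 < u \<and> u + s \<in> arrival_times z"
  then obtain m where u_eq: "u + s = arr z m" "0 < u" by (auto simp: arrival_times_def)
  then have "arrivals_upto z s \<le> m"
    using less_arrivals_upto_iff[OF reg, of m s] by auto
  then have "arr (residual s z) (m - arrivals_upto z s) = u"
    using u_eq(1) by (simp add: arr_residual flip: u_eq(1))
  then show "u \<in> arrival_times (residual s z)" by (auto simp: arrival_times_def)
qed

lemma regular_residual:
  assumes reg: "regular z"
  shows "regular (residual s z)"
  unfolding regular_def
proof safe
  fix m show "0 < residual s z m"
    using reg less_arrivals_upto_iff[OF reg, of "arrivals_upto z s" s]
    by (auto simp: residual_def regular_def)
next
  fix t
  obtain m where "t + s < arr z m" using reg by (auto simp: regular_def)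
  also have "arr z m \<le> arr z (arrivals_upto z s + m)"
    using strict_mono_arr[OF reg] by (simp add: strict_mono_less_eq)
  finally have "t < arr (residual s z) m" by (simp add: arr_residual)
  then show "\<exists>m. t < arr (residual s z) m" ..
qed

lemma arrivals_upto_residual:
  assumes reg: "regular z" and u_nonneg: "0 \<le> u"
  shows "arrivals_upto (residual s z) u + arrivals_upto z s = arrivals_upto z (u + s)"
proof -
  have "k < arrivals_upto (residual s z) u \<longleftrightarrow> arrivals_upto z s + k < arrivals_upto z (u + s)" for k
    by (auto simp: less_arrivals_upto_iff reg regular_residual arr_residual)
  from this[of "arrivals_upto (residual s z) u"]
    this[of "arrivals_upto z (u + s) - arrivals_upto z s"]
  show ?thesis using arrivals_upto_mono[OF reg, of s "u + s"] u_nonneg by linarith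
qed

lemma residual_residual:
  assumes "regular z" "0 \<le> u"
  shows "residual u (residual s z) = residual (u + s) z"
proof
  fix k
  have "arrivals_upto z s + arrivals_upto (residual s z) u = arrivals_upto z (u + s)"
    using arrivals_upto_residual[OF assms] by (simp add: add.commute)
  then show "residual u (residual s z) k = residual (u + s) z k"
    by (cases k) (simp_all add: residual_def[of u] residual_def[of "u + s"] arr_residual
        residual_def[of s z "Suc _"] flip: add.assoc)
qed

lemma next_arrival_mem: "residual s z 0 + s \<in> arrival_times z"
  by (auto simp: residual_def arrival_times_def)

lemma next_arrival_le:
  assumes reg: "regular z" and "u \<in> arrival_times z" "s < u"
  shows "residual s z 0 + s \<le> u"
proof -
  obtain m where u_eq: "u = arr z m" using assms(2) by (auto simp: arrival_times_def)
  then have "arrivals_upto z s \<le> m"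
    using less_arrivals_upto_iff[OF reg, of m s] \<open>s < u\<close> by auto
  then show ?thesis
    using strict_mono_arr[OF reg] by (simp add: residual_def u_eq strict_mono_less_eq)
qed

lemma residual_case_nat:
  assumes reg: "regular z"
  shows "residual t (case_nat a z) = (if a \<le> t then residual (t - a) z else case_nat (a - t) z)"
    and "arrivals_upto (case_nat a z) t = (if a \<le> t then Suc (arrivals_upto z (t - a)) else 0)"
proof -
  have "{m. arr (case_nat a z) m \<le> t} =
      (if a \<le> t then insert 0 (Suc ` {m. arr z m \<le> t - a}) else {})"
    (is "?L = ?R")
  proof (rule set_eqI)
    fix m show "m \<in> ?L \<longleftrightarrow> m \<in> ?R"
      using arr_pos[OF reg, of "m - 1"] by (cases m) (auto simp: arr_case_nat_0 arr_case_nat_Suc)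
  qed
  moreover have "finite {m. arr z m \<le> t - a}"
    by (simp flip: less_arrivals_upto_iff[OF reg])
  ultimately show arrivals_upto_eq:
    "arrivals_upto (case_nat a z) t = (if a \<le> t then Suc (arrivals_upto z (t - a)) else 0)"
    by (simp add: arrivals_upto_def card_image)
  show "residual t (case_nat a z) = (if a \<le> t then residual (t - a) z else case_nat (a - t) z)"
    by (rule ext)
      (simp add: residual_def arrivals_upto_eq arr_case_nat_0 arr_case_nat_Suc split: nat.split)
qed

section \<open>Exponential interarrival times\<close>

abbreviation seq_borel :: "(nat \<Rightarrow> real) measure" where
  "seq_borel \<equiv> PiM UNIV (\<lambda>_. borel)"

definition exponential_measure :: "real \<Rightarrow> real measure" where
  "exponential_measure r = density lborel (exponential_density r)"

definition exponential_seq :: "real \<Rightarrow> (nat \<Rightarrow> real) measure" where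
  "exponential_seq r = PiM UNIV (\<lambda>_. exponential_measure r)"

definition mean_arrivals :: "real \<Rightarrow> real \<Rightarrow> ennreal" where
  "mean_arrivals r t = (\<integral>\<^sup>+z. of_nat (arrivals_upto z t) \<partial>exponential_seq r)"

lemma sets_exponential_measure [simp, measurable_cong]: "sets (exponential_measure r) = sets borel"
  by (simp add: exponential_measure_def)

lemma space_exponential_measure [simp]: "space (exponential_measure r) = UNIV"
  by (simp add: exponential_measure_def)

lemma sets_exponential_seq [simp, measurable_cong]: "sets (exponential_seq r) = sets seq_borel"
  unfolding exponential_seq_def by (intro sets_PiM_cong) auto

lemma space_exponential_seq [simp]: "space (exponential_seq r) = UNIV"
  by (simp add: exponential_seq_def space_PiM)

lemma measurable_seqI: "(\<And>k. (\<lambda>x. f x k) \<in> borel_measurable M) \<Longrightarrow> f \<in> M \<rightarrow>\<^sub>M seq_borel"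
  by (rule measurable_PiM_single') (auto simp: space_PiM)

lemma measurable_arr [measurable (raw)]:
  assumes [measurable]: "g \<in> M \<rightarrow>\<^sub>M seq_borel"
  shows "(\<lambda>x. arr (g x) m) \<in> borel_measurable M"
  unfolding arr_def by measurable

lemma measurable_arrivals_upto [measurable (raw)]:
  assumes [measurable]: "g \<in> M \<rightarrow>\<^sub>M seq_borel" "f \<in> borel_measurable M"
  shows "(\<lambda>x. arrivals_upto (g x) (f x)) \<in> M \<rightarrow>\<^sub>M count_space UNIV"
  unfolding arrivals_upto_def by measurable

lemma measurable_case_nat_seq [measurable (raw)]:
  assumes [measurable]: "f \<in> borel_measurable M" "g \<in> M \<rightarrow>\<^sub>M seq_borel"
  shows "(\<lambda>x. case_nat (f x) (g x)) \<in> M \<rightarrow>\<^sub>M seq_borel"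
proof (rule measurable_seqI)
  show "(\<lambda>x. case_nat (f x) (g x) k) \<in> borel_measurable M" for k
    by (cases k) simp_all
qed

lemma measurable_residual [measurable (raw)]:
  assumes [measurable]: "f \<in> borel_measurable M" "g \<in> M \<rightarrow>\<^sub>M seq_borel"
  shows "(\<lambda>x. residual (f x) (g x)) \<in> M \<rightarrow>\<^sub>M seq_borel"
proof (rule measurable_seqI)
  have [measurable]: "(\<lambda>x. arrivals_upto (g x) (f x)) \<in> M \<rightarrow>\<^sub>M count_space UNIV" by measurable
  show "(\<lambda>x. residual (f x) (g x) k) \<in> borel_measurable M" for k
    unfolding residual_def
    by (rule measurable_compose_countable[where g = "\<lambda>x. arrivals_upto (g x) (f x)"
          and f = "\<lambda>N x. if k = 0 then arr (g x) N - f x else g x (N + k)"]) measurable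
qed

context
  fixes r :: real
  assumes rate_pos: "0 < r"
begin

lemma prob_space_exponential_measure: "prob_space (exponential_measure r)"
  unfolding exponential_measure_def by (rule prob_space_exponential_density[OF rate_pos])

interpretation interarrival: prob_space "exponential_measure r"
  by (rule prob_space_exponential_measure)

interpretation sequence_space "exponential_measure r"
  by unfold_locales

lemma prob_space_exponential_seq: "prob_space (exponential_seq r)"
  unfolding exponential_seq_def by (rule P.prob_space_axioms)

interpretation arrivals: prob_space "exponential_seq r"
  by (rule prob_space_exponential_seq)

lemma nn_integral_exponential_seq:
  assumes [measurable]: "f \<in> borel_measurable seq_borel"
  shows "(\<integral>\<^sup>+z. f z \<partial>exponential_seq r) =
    (\<integral>\<^sup>+a. \<integral>\<^sup>+z. f (case_nat a z) \<partial>exponential_seq r \<partial>exponential_measure r)"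
proof -
  have "(\<integral>\<^sup>+z. f z \<partial>exponential_seq r) =
      (\<integral>\<^sup>+z. f z \<partial>distr (exponential_measure r \<Otimes>\<^sub>M exponential_seq r) (exponential_seq r)
        (\<lambda>(a, z). case_nat a z))"
    unfolding exponential_seq_def by (subst PiM_iter) simp
  also have "\<dots> = (\<integral>\<^sup>+p. f (case p of (a, z) \<Rightarrow> case_nat a z)
      \<partial>(exponential_measure r \<Otimes>\<^sub>M exponential_seq r))"
    by (rule nn_integral_distr) measurable
  also have "\<dots> = (\<integral>\<^sup>+a. \<integral>\<^sup>+z. f (case_nat a z) \<partial>exponential_seq r \<partial>exponential_measure r)"
    by (subst arrivals.nn_integral_fst[symmetric]) auto
  finally show ?thesis .
qed

lemma measure_exponential_greaterThan:
  "0 \<le> t \<Longrightarrow> measure (exponential_measure r) {t<..} = exp (- r * t)"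
  using interarrival.exponential_distributedD_gt[of "\<lambda>a. a" r t] rate_pos
  by (simp add: distributed_def exponential_measure_def distr_id2 greaterThan_def mult.commute)

lemma AE_exponential_neq: "AE a in exponential_measure r. a \<noteq> t"
  using AE_lborel_singleton[of t] unfolding exponential_measure_def by (subst AE_density) auto

lemma AE_exponential_pos: "AE a in exponential_measure r. 0 < a"
  unfolding exponential_measure_def
proof (subst AE_density)
  show "AE a in lborel. 0 < ennreal (exponential_density r a) \<longrightarrow> 0 < a"
    using AE_lborel_singleton[of 0] by eventually_elim (auto simp: exponential_density_def not_less)
qed auto

lemma measure_exponential_atLeast:
  "0 \<le> t \<Longrightarrow> measure (exponential_measure r) {t..} = exp (- r * t)"
  using AE_exponential_neq[of t] measure_exponential_greaterThan[of t]
  by (subst measure_eq_AE[where B = "{t<..}"]) (auto elim!: eventually_mono)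

lemma measure_exponential_atMost:
  "0 \<le> t \<Longrightarrow> measure (exponential_measure r) {..t} = 1 - exp (- r * t)"
  using interarrival.exponential_distributedD_le[of "\<lambda>a. a" r t] rate_pos
  by (simp add: distributed_def exponential_measure_def distr_id2 atMost_def mult.commute)

lemma measure_exponential_interval:
  assumes "0 \<le> a" "a \<le> b"
  shows "measure (exponential_measure r) {a<..b} = exp (- r * a) - exp (- r * b)"
proof -
  have "{a<..b} = {a<..} - {b<..}" by auto
  with assms show ?thesis
    by (simp add: interarrival.finite_measure_Diff measure_exponential_greaterThan)
qed

lemma nn_integral_exponential_measure:
  assumes "h \<in> borel_measurable borel"
  shows "(\<integral>\<^sup>+a. h a \<partial>exponential_measure r) =
      (\<integral>\<^sup>+a. ennreal (exponential_density r a) * h a \<partial>lborel)"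
  unfolding exponential_measure_def using assms by (subst nn_integral_density) auto

lemma nn_integral_exponential_memoryless:
  assumes [measurable]: "g \<in> borel_measurable borel" and t_nonneg: "0 \<le> t"
  shows "(\<integral>\<^sup>+a. indicator {t<..} a * g (a - t) \<partial>exponential_measure r) =
    ennreal (exp (- r * t)) * (\<integral>\<^sup>+a. g a \<partial>exponential_measure r)"
proof -
  have shifted_density: "AE a in lborel.
      ennreal (exponential_density r (t + 1 * a)) * (indicator {t<..} (t + 1 * a) * g (t + 1 * a - t)) =
      ennreal (exp (- r * t)) * (ennreal (exponential_density r a) * g a)"
    using AE_lborel_singleton[of 0]
  proof eventually_elim
    case (elim a)
    show ?case
    proof (cases "a < 0")
      case False
      then have "exponential_density r (t + a) = exp (- r * t) * exponential_density r a"
        using t_nonneg by (simp add: exponential_density_def algebra_simps flip: exp_add)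
      then show ?thesis using False elim by (simp add: ennreal_mult' mult.assoc)
    qed (simp add: exponential_density_def)
  qed
  have "(\<integral>\<^sup>+a. indicator {t<..} a * g (a - t) \<partial>exponential_measure r) =
      (\<integral>\<^sup>+a. ennreal (exponential_density r (t + 1 * a)) *
        (indicator {t<..} (t + 1 * a) * g (t + 1 * a - t)) \<partial>lborel)"
    by (subst nn_integral_exponential_measure, measurable,
        subst nn_integral_real_affine[where c = 1 and t = t]) auto
  also have "\<dots> =
      (\<integral>\<^sup>+a. ennreal (exp (- r * t)) * (ennreal (exponential_density r a) * g a) \<partial>lborel)"
    by (rule nn_integral_cong_AE[OF shifted_density])
  also have "\<dots> = ennreal (exp (- r * t)) * (\<integral>\<^sup>+a. g a \<partial>exponential_measure r)"
    by (simp add: nn_integral_cmult nn_integral_exponential_measure)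
  finally show ?thesis .
qed

lemma AE_exponential_seq_pos: "AE z in exponential_seq r. \<forall>m. 0 < z m"
  unfolding AE_all_countable exponential_seq_def
  by (intro allI AE_PiM_component[where P = "\<lambda>a. 0 < a"] AE_exponential_pos
      prob_space_exponential_measure) auto

lemma nn_integral_indicator_arr_le:
  "(\<integral>\<^sup>+z. indicator {..t} (arr z m) \<partial>exponential_seq r) \<le>
      emeasure (exponential_measure r) {..t} ^ Suc m"
proof (induction m)
  case 0
  show ?case
    by (subst nn_integral_exponential_seq)
      (simp_all add: arr_case_nat_0 arrivals.emeasure_space_1[simplified])
next
  case (Suc m)
  let ?q = "emeasure (exponential_measure r) {..t}"
  have arr_nonneg: "AE z in exponential_seq r. 0 \<le> arr z m"
    using AE_exponential_seq_pos by eventually_elim (simp add: arr_def sum_nonneg less_imp_le)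
  have "(\<integral>\<^sup>+z. indicator {..t} (arr z (Suc m)) \<partial>exponential_seq r) =
      (\<integral>\<^sup>+a. \<integral>\<^sup>+z. indicator {..t} (a + arr z m) \<partial>exponential_seq r \<partial>exponential_measure r)"
    by (subst nn_integral_exponential_seq) (simp_all add: arr_case_nat_Suc)
  also have "\<dots> \<le> (\<integral>\<^sup>+a. indicator {..t} a * ?q ^ Suc m \<partial>exponential_measure r)"
  proof (rule nn_integral_mono_AE)
    show "AE a in exponential_measure r.
        (\<integral>\<^sup>+z. indicator {..t} (a + arr z m) \<partial>exponential_seq r) \<le> indicator {..t} a * ?q ^ Suc m"
      using AE_exponential_pos
    proof eventually_elim
      case (elim a)
      have "(\<integral>\<^sup>+z. indicator {..t} (a + arr z m) \<partial>exponential_seq r) \<le>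
          (\<integral>\<^sup>+z. indicator {..t} a * indicator {..t} (arr z m) \<partial>exponential_seq r)"
        using arr_nonneg elim
        by (intro nn_integral_mono_AE) (auto simp: indicator_def elim!: eventually_mono)
      also have "\<dots> \<le> indicator {..t} a * ?q ^ Suc m"
        by (subst nn_integral_cmult) (auto intro!: mult_left_mono Suc simp del: power_Suc)
      finally show ?case .
    qed
  qed
  also have "\<dots> = ?q ^ Suc (Suc m)"
    by (subst nn_integral_multc) auto
  finally show ?case .
qed

lemma nn_integral_suminf_arr_finite:
  assumes "0 \<le> t"
  shows "(\<integral>\<^sup>+z. (\<Sum>m. indicator {..t} (arr z m)) \<partial>exponential_seq r) < \<infinity>"
proof -
  define q where "q = 1 - exp (- r * t)"
  have q_bounds: "0 \<le> q" "q < 1" using assms rate_pos by (auto simp: q_def)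
  have "(\<integral>\<^sup>+z. (\<Sum>m. indicator {..t} (arr z m)) \<partial>exponential_seq r) =
      (\<Sum>m. \<integral>\<^sup>+z. indicator {..t} (arr z m) \<partial>exponential_seq r)"
    by (rule nn_integral_suminf) measurable
  also have "\<dots> \<le> (\<Sum>m. ennreal q ^ Suc m)"
    using nn_integral_indicator_arr_le[of t] measure_exponential_atMost[OF assms]
    by (intro suminf_le summableI) (simp add: interarrival.emeasure_eq_measure q_def)
  also have "\<dots> = (\<Sum>m. ennreal (q ^ Suc m))"
    using q_bounds(1) by (simp add: ennreal_power del: power_Suc)
  also have "\<dots> = ennreal (\<Sum>m. q ^ Suc m)"
  proof (rule suminf_ennreal2)
    show "summable (\<lambda>m. q ^ Suc m)"
      using q_bounds by (subst summable_Suc_iff) (auto intro: summable_geometric)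
    show "0 \<le> q ^ Suc m" for m using q_bounds(1) by simp
  qed
  also have "\<dots> < \<infinity>" by simp
  finally show ?thesis .
qed

lemma AE_regular: "AE z in exponential_seq r. regular z"
proof -
  have "AE z in exponential_seq r. \<forall>t::nat. (\<Sum>m. indicator {..real t} (arr z m) :: ennreal) \<noteq> \<infinity>"
    unfolding AE_all_countable
    using nn_integral_suminf_arr_finite by (intro allI nn_integral_PInf_AE) (auto simp: less_top)
  with AE_exponential_seq_pos show ?thesis
  proof eventually_elim
    case (elim z)
    have "\<exists>m. t < arr z m" for t
    proof (rule ccontr)
      assume bounded: "\<nexists>m. t < arr z m"
      obtain k :: nat where "t \<le> real k" using real_arch_simple by blast
      with bounded have "arr z m \<le> real k" for m by (meson not_less order_trans)
      then have "(\<lambda>m. indicator {..real k} (arr z m) :: ennreal) = (\<lambda>_. 1)" by auto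
      moreover have "(\<Sum>m::nat. 1 :: ennreal) = \<infinity>"
        by (simp add: suminf_eq_SUP ennreal_SUP_of_nat_eq_top)
      ultimately show False using elim(2)[rule_format, of k] by simp
    qed
    with elim(1) show ?case by (simp add: regular_def)
  qed
qed

lemma nn_integral_residual_first_arrival:
  assumes [measurable]: "\<And>m. case_prod (f m) \<in> borel_measurable (borel \<Otimes>\<^sub>M seq_borel)"
  shows "(\<integral>\<^sup>+z. f (arrivals_upto z t) (z 0) (residual t z) \<partial>exponential_seq r) =
    (\<integral>\<^sup>+a. \<integral>\<^sup>+z. (if a \<le> t then f (Suc (arrivals_upto z (t - a))) a (residual (t - a) z)
        else f 0 a (case_nat (a - t) z)) \<partial>exponential_seq r \<partial>exponential_measure r)"
proof -
  have "(\<lambda>z. f (arrivals_upto z t) (z 0) (residual t z)) \<in> borel_measurable seq_borel"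
    by (rule measurable_compose_countable[where g = "\<lambda>z. arrivals_upto z t"
          and f = "\<lambda>m z. f m (z 0) (residual t z)"]) measurable
  then have "(\<integral>\<^sup>+z. f (arrivals_upto z t) (z 0) (residual t z) \<partial>exponential_seq r) =
      (\<integral>\<^sup>+a. \<integral>\<^sup>+z. f (arrivals_upto (case_nat a z) t) (case_nat a z 0) (residual t (case_nat a z))
        \<partial>exponential_seq r \<partial>exponential_measure r)"
    by (rule nn_integral_exponential_seq)
  also have "\<dots> =
      (\<integral>\<^sup>+a. \<integral>\<^sup>+z. (if a \<le> t then f (Suc (arrivals_upto z (t - a))) a (residual (t - a) z)
        else f 0 a (case_nat (a - t) z)) \<partial>exponential_seq r \<partial>exponential_measure r)"
    using AE_regular
    by (intro nn_integral_cong nn_integral_cong_AE)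
      (auto simp: residual_case_nat elim!: eventually_mono)
  finally show ?thesis .
qed

lemma nn_integral_no_arrival_residual:
  assumes [measurable]: "h \<in> borel_measurable seq_borel" and t_nonneg: "0 \<le> t"
  shows "(\<integral>\<^sup>+z. of_bool (arrivals_upto z t = 0) * h (residual t z) \<partial>exponential_seq r) =
    ennreal (exp (- r * t)) * (\<integral>\<^sup>+z. h z \<partial>exponential_seq r)"
proof -
  have "(\<integral>\<^sup>+z. of_bool (arrivals_upto z t = 0) * h (residual t z) \<partial>exponential_seq r) =
      (\<integral>\<^sup>+a. \<integral>\<^sup>+z. (if a \<le> t then 0 else h (case_nat (a - t) z))
        \<partial>exponential_seq r \<partial>exponential_measure r)"
    by (subst nn_integral_residual_first_arrival[where f = "\<lambda>m _ z. of_bool (m = 0) * h z"])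
      (simp_all cong: if_cong)
  also have "\<dots> = (\<integral>\<^sup>+a. indicator {t<..} a * (\<integral>\<^sup>+z. h (case_nat (a - t) z) \<partial>exponential_seq r)
      \<partial>exponential_measure r)"
    by (intro nn_integral_cong) (auto simp: indicator_def)
  also have "\<dots> = ennreal (exp (- r * t)) *
      (\<integral>\<^sup>+a. \<integral>\<^sup>+z. h (case_nat a z) \<partial>exponential_seq r \<partial>exponential_measure r)"
    using t_nonneg by (intro nn_integral_exponential_memoryless) measurable
  finally show ?thesis by (simp add: nn_integral_exponential_seq[symmetric])
qed

lemma nn_integral_Suc_arrivals_residual:
  assumes [measurable]: "h \<in> borel_measurable seq_borel"
  shows "(\<integral>\<^sup>+z. of_bool (arrivals_upto z t = Suc m) * h (residual t z) \<partial>exponential_seq r) =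
    (\<integral>\<^sup>+a. indicator {..t} a * (\<integral>\<^sup>+z. of_bool (arrivals_upto z (t - a) = m) * h (residual (t - a) z)
      \<partial>exponential_seq r) \<partial>exponential_measure r)"
  by (subst nn_integral_residual_first_arrival[where f = "\<lambda>N _ z. of_bool (N = Suc m) * h z"])
    (auto simp: indicator_def intro!: nn_integral_cong)

lemma nn_integral_arrivals_residual:
  assumes h_meas: "h \<in> borel_measurable seq_borel" and t_nonneg: "0 \<le> t"
  shows "(\<integral>\<^sup>+z. of_bool (arrivals_upto z t = m) * h (residual t z) \<partial>exponential_seq r) =
    (\<integral>\<^sup>+z. of_bool (arrivals_upto z t = m) \<partial>exponential_seq r) * (\<integral>\<^sup>+z. h z \<partial>exponential_seq r)"
  using t_nonneg
proof (induction m arbitrary: t)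
  case 0
  then show ?case
    using nn_integral_no_arrival_residual[OF h_meas] nn_integral_no_arrival_residual[of "\<lambda>_. 1"]
    by (simp add: arrivals.emeasure_space_1[simplified])
next
  case (Suc m)
  let ?N = "\<lambda>t m. \<integral>\<^sup>+z. of_bool (arrivals_upto z t = m) \<partial>exponential_seq r"
  have "(\<integral>\<^sup>+z. of_bool (arrivals_upto z t = Suc m) * h (residual t z) \<partial>exponential_seq r) =
      (\<integral>\<^sup>+a. (indicator {..t} a * ?N (t - a) m) * (\<integral>\<^sup>+z. h z \<partial>exponential_seq r) \<partial>exponential_measure r)"
    unfolding nn_integral_Suc_arrivals_residual[OF h_meas]
    by (intro nn_integral_cong) (auto simp: Suc.IH indicator_def)
  also have "\<dots> = (\<integral>\<^sup>+a. indicator {..t} a * ?N (t - a) m \<partial>exponential_measure r) *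
      (\<integral>\<^sup>+z. h z \<partial>exponential_seq r)"
    by (rule nn_integral_multc) measurable
  also have "(\<integral>\<^sup>+a. indicator {..t} a * ?N (t - a) m \<partial>exponential_measure r) = ?N t (Suc m)"
    using nn_integral_Suc_arrivals_residual[of "\<lambda>_. 1"] by simp
  finally show ?case .
qed

lemma nn_integral_residual:
  assumes [measurable]: "h \<in> borel_measurable seq_borel" and "0 \<le> t"
  shows "(\<integral>\<^sup>+z. h (residual t z) \<partial>exponential_seq r) = (\<integral>\<^sup>+z. h z \<partial>exponential_seq r)"
proof -
  have sum_arrivals: "(\<Sum>m. of_bool (arrivals_upto z t = m) * y) = (y :: ennreal)" for z y
    by (subst suminf_finite[of "{arrivals_upto z t}"]) auto
  have "(\<integral>\<^sup>+z. h (residual t z) \<partial>exponential_seq r) =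
      (\<Sum>m. \<integral>\<^sup>+z. of_bool (arrivals_upto z t = m) * h (residual t z) \<partial>exponential_seq r)"
    by (subst nn_integral_suminf[symmetric]) (simp_all add: sum_arrivals del: ennreal_suminf_multc)
  also have "\<dots> = (\<Sum>m. \<integral>\<^sup>+z. of_bool (arrivals_upto z t = m) \<partial>exponential_seq r) *
      (\<integral>\<^sup>+z. h z \<partial>exponential_seq r)"
    using nn_integral_arrivals_residual[OF assms] by simp
  also have "(\<Sum>m. \<integral>\<^sup>+z. of_bool (arrivals_upto z t = m) \<partial>exponential_seq r) = 1"
    using sum_arrivals[of _ 1] arrivals.emeasure_space_1
    by (subst nn_integral_suminf[symmetric]) simp_all
  finally show ?thesis by simp
qed

lemma nn_integral_min_first_residual:
  assumes [measurable]: "f \<in> borel_measurable borel" "h \<in> borel_measurable seq_borel"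
    and w_nonneg: "0 \<le> w"
  shows "(\<integral>\<^sup>+z. f (min (z 0) w) * h (residual w z) \<partial>exponential_seq r) =
    (\<integral>\<^sup>+a. f (min a w) \<partial>exponential_measure r) * (\<integral>\<^sup>+z. h z \<partial>exponential_seq r)"
    (is "_ = _ * ?H")
proof -
  define g where "g a = (\<integral>\<^sup>+z. h (case_nat a z) \<partial>exponential_seq r)" for a
  have [measurable]: "g \<in> borel_measurable borel" unfolding g_def by measurable
  have "(\<integral>\<^sup>+z. f (min (z 0) w) * h (residual w z) \<partial>exponential_seq r) =
      (\<integral>\<^sup>+a. \<integral>\<^sup>+z. (if a \<le> w then f (min a w) * h (residual (w - a) z)
          else f (min a w) * h (case_nat (a - w) z))
        \<partial>exponential_seq r \<partial>exponential_measure r)"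
    by (rule nn_integral_residual_first_arrival[where f = "\<lambda>_ a z. f (min a w) * h z"]) measurable
  also have "\<dots> = (\<integral>\<^sup>+a. f (min a w) * indicator {..w} a * ?H +
      f w * (indicator {w<..} a * g (a - w)) \<partial>exponential_measure r)"
    by (intro nn_integral_cong)
      (auto simp: indicator_def nn_integral_cmult nn_integral_residual g_def)
  also have "\<dots> = (\<integral>\<^sup>+a. f (min a w) * indicator {..w} a \<partial>exponential_measure r) * ?H +
      f w * (\<integral>\<^sup>+a. indicator {w<..} a * g (a - w) \<partial>exponential_measure r)"
    by (subst nn_integral_add) (simp_all add: nn_integral_multc nn_integral_cmult)
  also have "(\<integral>\<^sup>+a. indicator {w<..} a * g (a - w) \<partial>exponential_measure r) =
      (\<integral>\<^sup>+a. indicator {w<..} a \<partial>exponential_measure r) * ?H"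
    using w_nonneg nn_integral_exponential_memoryless[of g w]
    by (simp add: nn_integral_exponential_seq[of h] interarrival.emeasure_eq_measure
        measure_exponential_greaterThan flip: g_def)
  also have "(\<integral>\<^sup>+a. f (min a w) * indicator {..w} a \<partial>exponential_measure r) * ?H +
        f w * ((\<integral>\<^sup>+a. indicator {w<..} a \<partial>exponential_measure r) * ?H) =
      (\<integral>\<^sup>+a. f (min a w) * indicator {..w} a + f w * indicator {w<..} a \<partial>exponential_measure r) * ?H"
    by (subst nn_integral_add) (simp_all add: nn_integral_cmult distrib_right mult.assoc)
  also have "\<dots> = (\<integral>\<^sup>+a. f (min a w) \<partial>exponential_measure r) * ?H"
    by (intro arg_cong2[where f = times] nn_integral_cong) (auto simp: indicator_def)
  finally show ?thesis .
qed

lemma measure_min_first_residual: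
  assumes [measurable]: "A \<in> sets borel" "H \<in> sets seq_borel" and w_nonneg: "0 \<le> w"
  shows "measure (exponential_seq r) {z. min (z 0) w \<in> A \<and> residual w z \<in> H} =
    measure (exponential_seq r) {z. min (z 0) w \<in> A} * measure (exponential_seq r) {z. residual w z \<in> H}"
proof -
  have emeasure_eq: "emeasure (exponential_seq r) {z. min (z 0) w \<in> A \<and> residual w z \<in> B} =
      emeasure (exponential_measure r) {a. min a w \<in> A} * emeasure (exponential_seq r) B"
    if [measurable]: "A \<in> sets borel" "B \<in> sets seq_borel" for A B
  proof -
    have "emeasure (exponential_seq r)
        {z \<in> space (exponential_seq r). min (z 0) w \<in> A \<and> residual w z \<in> B} =
        (\<integral>\<^sup>+z. indicator A (min (z 0) w) * indicator B (residual w z) \<partial>exponential_seq r)"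
      by (subst nn_integral_indicator[symmetric], measurable)
        (auto simp: indicator_def intro!: nn_integral_cong)
    also have "\<dots> =
        (\<integral>\<^sup>+a. indicator A (min a w) \<partial>exponential_measure r) * emeasure (exponential_seq r) B"
      by (subst nn_integral_min_first_residual) (simp_all add: w_nonneg)
    also have "(\<integral>\<^sup>+a. indicator A (min a w) \<partial>exponential_measure r) =
        (\<integral>\<^sup>+a. indicator {a \<in> space (exponential_measure r). min a w \<in> A} a \<partial>exponential_measure r)"
      by (intro nn_integral_cong) (auto simp: indicator_def)
    also have "\<dots> =
        emeasure (exponential_measure r) {a \<in> space (exponential_measure r). min a w \<in> A}"
      by (rule nn_integral_indicator) measurable
    finally show ?thesis by simp
  qed
  have "emeasure (exponential_seq r) UNIV = 1" "emeasure (exponential_measure r) UNIV = 1"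
    using arrivals.emeasure_space_1 interarrival.emeasure_space_1 by simp_all
  moreover have "UNIV \<in> sets seq_borel"
    using sets.top[of seq_borel] by (simp add: space_PiM)
  ultimately show ?thesis
    using emeasure_eq[of A H] emeasure_eq[of A UNIV] emeasure_eq[of UNIV H]
    by (simp add: measure_def enn2real_mult)
qed

lemma measure_exponential_seq_first:
  assumes "A \<in> sets borel"
  shows "measure (exponential_seq r) {z. z 0 \<in> A} = measure (exponential_measure r) A"
proof -
  have "distr (exponential_seq r) (exponential_measure r) (\<lambda>z. z 0) = exponential_measure r"
    unfolding exponential_seq_def by (rule PiM_component) simp
  from arg_cong[OF this, of "\<lambda>N. measure N A"] assms show ?thesis
    by (simp add: measure_distr vimage_def)
qed

lemma distr_residual:
  assumes "0 \<le> t"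
  shows "distr (exponential_seq r) (exponential_seq r) (residual t) = exponential_seq r"
proof (rule measure_eqI)
  fix H assume "H \<in> sets (distr (exponential_seq r) (exponential_seq r) (residual t))"
  then have [measurable]: "H \<in> sets seq_borel" by simp
  have "emeasure (distr (exponential_seq r) (exponential_seq r) (residual t)) H =
      (\<integral>\<^sup>+z. indicator H (residual t z) \<partial>exponential_seq r)"
    by (subst nn_integral_distr[where M' = "exponential_seq r", symmetric]) simp_all
  also have "\<dots> = emeasure (exponential_seq r) H"
    using assms by (subst nn_integral_residual) simp_all
  finally show "emeasure (distr (exponential_seq r) (exponential_seq r) (residual t)) H =
      emeasure (exponential_seq r) H" .
qed simp

lemma nn_integral_arrivals_increment:
  assumes "0 \<le> a" "a \<le> b"
  shows "(\<integral>\<^sup>+z. of_nat (arrivals_upto z b - arrivals_upto z a) \<partial>exponential_seq r) =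
      mean_arrivals r (b - a)"
proof -
  have "arrivals_upto z b - arrivals_upto z a = arrivals_upto (residual a z) (b - a)"
    if "regular z" for z
    using arrivals_upto_residual[OF that, of "b - a" a] assms by simp
  then have "(\<integral>\<^sup>+z. of_nat (arrivals_upto z b - arrivals_upto z a) \<partial>exponential_seq r) =
      (\<integral>\<^sup>+z. of_nat (arrivals_upto (residual a z) (b - a)) \<partial>exponential_seq r)"
    using AE_regular by (intro nn_integral_cong_AE) (auto elim!: eventually_mono)
  also have "\<dots> = mean_arrivals r (b - a)"
    unfolding mean_arrivals_def using assms by (intro nn_integral_residual) measurable
  finally show ?thesis .
qed

lemma mean_arrivals_finite:
  assumes "0 \<le> t"
  shows "mean_arrivals r t < \<infinity>"
proof -
  have "AE z in exponential_seq r. of_nat (arrivals_upto z t) =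
      (\<Sum>m. indicator {..t} (arr z m) :: ennreal)"
    using AE_regular
  proof eventually_elim
    case (elim z)
    have "(\<Sum>m. indicator {..t} (arr z m) :: ennreal) =
        (\<Sum>m<arrivals_upto z t. indicator {..t} (arr z m))"
      by (rule suminf_finite) (auto simp: less_arrivals_upto_iff[OF elim])
    also have "\<dots> = (\<Sum>m<arrivals_upto z t. 1)"
      by (intro sum.cong) (auto simp: less_arrivals_upto_iff[OF elim])
    finally show ?case by simp
  qed
  then have "mean_arrivals r t = (\<integral>\<^sup>+z. (\<Sum>m. indicator {..t} (arr z m)) \<partial>exponential_seq r)"
    unfolding mean_arrivals_def by (rule nn_integral_cong_AE)
  then show ?thesis using nn_integral_suminf_arr_finite[OF assms] by simp
qed

end

section \<open>Independent Poisson processes\<close>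

abbreviation family_borel :: "'k set \<Rightarrow> ('k \<Rightarrow> nat \<Rightarrow> real) measure" where
  "family_borel I \<equiv> PiM I (\<lambda>_. seq_borel)"

definition regular_on :: "'k set \<Rightarrow> ('k \<Rightarrow> nat \<Rightarrow> real) \<Rightarrow> bool" where
  "regular_on I x \<longleftrightarrow> (\<forall>k\<in>I. regular (x k))"

definition residual_on :: "'k set \<Rightarrow> real \<Rightarrow> ('k \<Rightarrow> nat \<Rightarrow> real) \<Rightarrow> 'k \<Rightarrow> nat \<Rightarrow> real" where
  "residual_on I s x = (\<lambda>k\<in>I. residual s (x k))"

lemma regular_onD: "regular_on I x \<Longrightarrow> k \<in> I \<Longrightarrow> regular (x k)"
  by (simp add: regular_on_def)

lemma residual_on_apply: "k \<in> I \<Longrightarrow> residual_on I s x k = residual s (x k)"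
  by (simp add: residual_on_def)

lemma regular_on_residual_on: "regular_on I x \<Longrightarrow> regular_on I (residual_on I s x)"
  by (simp add: regular_on_def residual_on_def regular_residual)

lemma residual_on_residual_on:
  "regular_on I x \<Longrightarrow> 0 \<le> u \<Longrightarrow> residual_on I u (residual_on I s x) = residual_on I (u + s) x"
  by (simp add: residual_on_def regular_on_def residual_residual cong: restrict_cong)

lemma measurable_residual_on [measurable]: "residual_on I s \<in> family_borel I \<rightarrow>\<^sub>M family_borel I"
  unfolding residual_on_def[abs_def] by (rule measurable_restrict) measurable

lemma measurable_family_nth:
  assumes "k \<in> I"
  shows "(\<lambda>x. x k m) \<in> borel_measurable (family_borel I)"
  using measurable_component_singleton[OF assms] by (rule measurable_compose) simp

lemma measurable_family_arr [measurable]: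
  assumes "k \<in> I"
  shows "(\<lambda>x. arr (x k) m) \<in> borel_measurable (family_borel I)"
  using measurable_component_singleton[OF assms] by (rule measurable_arr)

lemma (in prob_space) distr_exponential_families:
  assumes indep: "indep_vars (\<lambda>_. borel) (\<lambda>(k, m). X k m) (I \<times> UNIV)" and I_nonempty: "I \<noteq> {}"
    and dist: "\<And>k m. k \<in> I \<Longrightarrow> distributed M lborel (X k m) (exponential_density (\<rho> k))"
  shows "(\<lambda>\<omega>. \<lambda>k\<in>I. \<lambda>m. X k m \<omega>) \<in> M \<rightarrow>\<^sub>M family_borel I"
    and "distr M (family_borel I) (\<lambda>\<omega>. \<lambda>k\<in>I. \<lambda>m. X k m \<omega>) = PiM I (\<lambda>k. exponential_seq (\<rho> k))"
proof -
  have X_meas: "X k m \<in> borel_measurable M" if "k \<in> I" for k m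
    using distributed_measurable[OF dist[OF that, of m]] by simp
  then have seq_meas: "(\<lambda>\<omega> m. X k m \<omega>) \<in> M \<rightarrow>\<^sub>M seq_borel" if "k \<in> I" for k
    using that by (intro measurable_seqI)
  then show "(\<lambda>\<omega>. \<lambda>k\<in>I. \<lambda>m. X k m \<omega>) \<in> M \<rightarrow>\<^sub>M family_borel I"
    by (rule measurable_restrict)
  have distr_seq: "distr M seq_borel (\<lambda>\<omega> m. X k m \<omega>) = exponential_seq (\<rho> k)"
    if k_mem: "k \<in> I" for k
  proof -
    have "distr M borel (X k m) = exponential_measure (\<rho> k)" for m
      using distributed_distr_eq_density[OF dist[OF k_mem, of m]]
      by (simp add: exponential_measure_def cong: distr_cong)
    moreover have "distr M seq_borel (\<lambda>\<omega>. \<lambda>m\<in>UNIV. X k m \<omega>) = PiM UNIV (\<lambda>m. distr M borel (X k m))"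
      using indep_vars_section[OF indep k_mem] X_meas[OF k_mem]
      by (subst (asm) indep_vars_iff_distr_eq_PiM') auto
    ultimately show ?thesis by (simp add: exponential_seq_def restrict_UNIV)
  qed
  have "distr M (family_borel I) (\<lambda>\<omega>. \<lambda>k\<in>I. \<lambda>m. X k m \<omega>) =
      PiM I (\<lambda>k. distr M seq_borel (\<lambda>\<omega> m. X k m \<omega>))"
    using indep_vars_sequences[OF indep] seq_meas I_nonempty
    by (subst (asm) indep_vars_iff_distr_eq_PiM') auto
  also have "\<dots> = PiM I (\<lambda>k. exponential_seq (\<rho> k))"
    by (intro PiM_cong refl distr_seq)
  finally show "distr M (family_borel I) (\<lambda>\<omega>. \<lambda>k\<in>I. \<lambda>m. X k m \<omega>) =
      PiM I (\<lambda>k. exponential_seq (\<rho> k))" .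
qed

locale poisson_family =
  fixes I :: "'k set" and \<rho> :: "'k \<Rightarrow> real"
  assumes finite_index: "finite I" and rate_pos: "0 < \<rho> k"
begin

sublocale product_prob_space "\<lambda>k. exponential_seq (\<rho> k)" I
  by (intro product_prob_spaceI prob_space_exponential_seq rate_pos)

abbreviation law :: "('k \<Rightarrow> nat \<Rightarrow> real) measure" where
  "law \<equiv> PiM I (\<lambda>k. exponential_seq (\<rho> k))"

lemma sets_law [measurable_cong]: "sets law = sets (family_borel I)"
  by (intro sets_PiM_cong) auto

lemma space_law: "space law = extensional I"
  by (auto simp: space_PiM PiE_def)

lemma AE_regular_on: "AE x in law. regular_on I x"
  unfolding regular_on_def
  by (intro AE_finite_allI finite_index AE_component AE_regular rate_pos)

lemma distr_residual_on:
  assumes "0 \<le> s"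
  shows "distr law law (residual_on I s) = law"
proof -
  have "distr law law (compose I (residual s)) =
      PiM I (\<lambda>k. distr (exponential_seq (\<rho> k)) (exponential_seq (\<rho> k)) (residual s))"
    by (rule distr_PiM_finite_prob_space[OF finite_index product_prob_space_axioms
        product_prob_space_axioms]) measurable
  moreover have "compose I (residual s) = residual_on I s"
    by (simp add: fun_eq_iff compose_def residual_on_def)
  ultimately show ?thesis
    using assms by (simp add: distr_residual rate_pos)
qed

lemma nn_integral_residual_on:
  assumes "0 \<le> s" and [measurable]: "f \<in> borel_measurable (family_borel I)"
  shows "(\<integral>\<^sup>+x. f (residual_on I s x) \<partial>law) = (\<integral>\<^sup>+x. f x \<partial>law)"
proof -
  have "(\<integral>\<^sup>+x. f x \<partial>distr law law (residual_on I s)) = (\<integral>\<^sup>+x. f (residual_on I s x) \<partial>law)"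
    by (rule nn_integral_distr) measurable
  then show ?thesis by (simp add: distr_residual_on assms(1))
qed

lemma prob_residual_on:
  assumes "0 \<le> s" and [measurable]: "H \<in> sets (family_borel I)"
  shows "P.prob {x \<in> space law. residual_on I s x \<in> H} = P.prob H"
proof -
  have "P.prob H = measure (distr law law (residual_on I s)) H"
    by (simp add: distr_residual_on assms(1))
  also have "\<dots> = P.prob (residual_on I s -` H \<inter> space law)"
    by (rule measure_distr) measurable
  also have "residual_on I s -` H \<inter> space law = {x \<in> space law. residual_on I s x \<in> H}" by auto
  finally show ?thesis by simp
qed

lemma prob_first_arrivals:
  assumes A_sets: "\<And>k. k \<in> I \<Longrightarrow> A k \<in> sets borel"
  shows "P.prob {x \<in> space law. \<forall>k\<in>I. x k 0 \<in> A k} =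
      (\<Prod>k\<in>I. measure (exponential_measure (\<rho> k)) (A k))"
proof -
  have "{x \<in> space law. \<forall>k\<in>I. x k 0 \<in> A k} = PiE I (\<lambda>k. {z. z 0 \<in> A k})"
    by (auto simp: space_law PiE_def)
  moreover have "{z. z 0 \<in> A k} \<in> sets seq_borel" if "k \<in> I" for k
  proof -
    note [measurable] = A_sets[OF that]
    have "{z \<in> space seq_borel. z 0 \<in> A k} \<in> sets seq_borel" by measurable
    then show ?thesis by (simp add: space_PiM)
  qed
  ultimately show ?thesis
    using A_sets by (simp add: measure_PiM finite_index measure_exponential_seq_first rate_pos)
qed

text \<open>A first arrival truncated at \<open>w\<close> is determined by the arrivals up to time \<open>w\<close>; hence the \<open>min\<close>.\<close>

lemma prob_min_first_residual_on:
  assumes w_nonneg: "0 \<le> w" and E_sets: "E \<in> sets (PiM I (\<lambda>_. borel))"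
    and H_sets: "H \<in> sets (family_borel I)"
  shows "P.prob {x \<in> space law. (\<lambda>k\<in>I. min (x k 0) w) \<in> E \<and> residual_on I w x \<in> H} =
    P.prob {x \<in> space law. (\<lambda>k\<in>I. min (x k 0) w) \<in> E} * P.prob H"
proof -
  have "P.prob {x \<in> space law. (\<lambda>k\<in>I. min (x k 0) w) \<in> E \<and> (\<lambda>k\<in>I. residual w (x k)) \<in> H} =
    P.prob {x \<in> space law. (\<lambda>k\<in>I. min (x k 0) w) \<in> E} * P.prob {x \<in> space law. (\<lambda>k\<in>I. residual w (x k)) \<in> H}"
    by (rule prob_PiM_coordinatewise_indep[OF finite_index _ _ _ E_sets H_sets])
      (simp_all add: measure_min_first_residual rate_pos w_nonneg)
  then show ?thesis
    using prob_residual_on[OF w_nonneg H_sets] by (simp add: residual_on_def)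
qed

end

section \<open>Versions and ages along a sample path\<close>

lemma procs_simps [simp]:
  "Gen \<in> procs n" "Src j \<in> procs n \<longleftrightarrow> j \<in> {1..n}"
  "Gsp j i \<in> procs n \<longleftrightarrow> j \<in> {1..n} \<and> i \<in> {1..n} \<and> j \<noteq> i"
  by (auto simp: procs_def)

lemma finite_procs [simp]: "finite (procs n)"
proof -
  have "procs n \<subseteq> {Gen} \<union> Src ` {1..n} \<union> (\<lambda>(j, i). Gsp j i) ` ({1..n} \<times> {1..n})"
    by (auto simp: procs_def)
  then show ?thesis by (rule finite_subset) auto
qed

lemma src_ver_eq: "src_ver x t = arrivals_upto (x Gen) t"
  by (simp add: src_ver_def arrivals_upto_def)

lemma src_ver_mono: "regular_on (procs n) x \<Longrightarrow> s \<le> t \<Longrightarrow> src_ver x s \<le> src_ver x t"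
  by (simp add: src_ver_eq arrivals_upto_mono regular_onD)

lemma src_ver_less_imp_less: "regular_on (procs n) x \<Longrightarrow> src_ver x s < src_ver x t \<Longrightarrow> s < t"
  using src_ver_mono[of n x t s] by force

lemma gossiping_iff:
  "gossiping x \<delta> j t \<longleftrightarrow> (\<exists>u\<in>arrival_times (x (Src j)). u \<le> t \<and> t < u + \<delta>)"
  by (simp add: gossiping_def arrival_times_def)

lemma has_ver_from_src_arrival:
  "i \<in> {1..n} \<Longrightarrow> u \<in> arrival_times (x (Src i)) \<Longrightarrow> u \<le> t \<Longrightarrow> has_ver n x \<delta> i t (src_ver x u)"
  by (auto simp: arrival_times_def intro: has_ver.from_src)

lemma has_ver_from_gossip_arrival:
  "i \<in> {1..n} \<Longrightarrow> j \<in> {1..n} \<Longrightarrow> j \<noteq> i \<Longrightarrow> has_ver n x \<delta> j s v \<Longrightarrow> u \<in> arrival_times (x (Gsp j i)) \<Longrightarrow>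
    s < u \<Longrightarrow> u \<le> t \<Longrightarrow> delivered n x \<delta> j u \<Longrightarrow> has_ver n x \<delta> i t v"
  by (auto simp: arrival_times_def intro: has_ver.from_gossip)

lemma has_ver_le_src_ver:
  assumes reg: "regular_on (procs n) x" and "has_ver n x \<delta> i t v"
  shows "v \<le> src_ver x t"
  using assms(2)
proof induction
  case (from_src i m t)
  then show ?case by (intro src_ver_mono[OF reg])
next
  case (from_gossip i j s v m t)
  then have "src_ver x s \<le> src_ver x t" by (intro src_ver_mono[OF reg]) simp
  with from_gossip.IH show ?case by simp
qed simp

lemma has_ver_node_ver:
  assumes "regular_on (procs n) x"
  shows "has_ver n x \<delta> i t (node_ver n x \<delta> i t)"
  unfolding node_ver_def
  by (rule GreatestI_nat[of _ 0 "src_ver x t"])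
    (auto intro: has_ver.init has_ver_le_src_ver[OF assms])

lemma has_ver_le_node_ver:
  assumes "regular_on (procs n) x" "has_ver n x \<delta> i t v"
  shows "v \<le> node_ver n x \<delta> i t"
  unfolding node_ver_def
  by (rule Greatest_le_nat[of _ _ "src_ver x t"]) (auto intro: assms has_ver_le_src_ver)

lemma node_ver_le_src_ver: "regular_on (procs n) x \<Longrightarrow> node_ver n x \<delta> i t \<le> src_ver x t"
  using has_ver_le_src_ver has_ver_node_ver by blast

definition trunc_age ::
  "nat \<Rightarrow> real \<Rightarrow> nat \<Rightarrow> real \<Rightarrow> real \<Rightarrow> (proc \<Rightarrow> nat \<Rightarrow> real) \<Rightarrow> real" where
  "trunc_age n \<delta> i a t x = min (age n x \<delta> i t) (real (src_ver x t) - real (src_ver x a))"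

lemma trunc_age_eq:
  "trunc_age n \<delta> i a t x = real (src_ver x t) - real (max (node_ver n x \<delta> i t) (src_ver x a))"
  by (auto simp: trunc_age_def age_def max_def)

lemma trunc_age_nonneg:
  assumes "regular_on (procs n) x" "a \<le> t"
  shows "0 \<le> trunc_age n \<delta> i a t x"
  using node_ver_le_src_ver[OF assms(1)] src_ver_mono[OF assms] by (simp add: trunc_age_eq)

lemma trunc_age_antimono:
  assumes "regular_on (procs n) x" "a \<le> b"
  shows "trunc_age n \<delta> i b t x \<le> trunc_age n \<delta> i a t x"
  using src_ver_mono[OF assms] by (auto simp: trunc_age_eq)

lemma trunc_age_0: "regular_on (procs n) x \<Longrightarrow> trunc_age n \<delta> i 0 t x = age n x \<delta> i t"
  by (simp add: trunc_age_eq age_def src_ver_eq arrivals_upto_0 regular_onD)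

subsection \<open>Shift invariance of the truncated age\<close>

definition shifted_after ::
  "nat \<Rightarrow> real \<Rightarrow> real \<Rightarrow> (proc \<Rightarrow> nat \<Rightarrow> real) \<Rightarrow> (proc \<Rightarrow> nat \<Rightarrow> real) \<Rightarrow> bool" where
  "shifted_after n c s x y \<longleftrightarrow>
    (\<forall>k\<in>procs n. \<forall>u>c. u \<in> arrival_times (x k) \<longleftrightarrow> u + s \<in> arrival_times (y k))"

lemma shifted_afterD:
  "shifted_after n c s x y \<Longrightarrow> k \<in> procs n \<Longrightarrow> c < u \<Longrightarrow>
    u \<in> arrival_times (x k) \<longleftrightarrow> u + s \<in> arrival_times (y k)"
  by (simp add: shifted_after_def)

lemma shifted_after_sym:
  assumes "shifted_after n c s x y"
  shows "shifted_after n (c + s) (- s) y x"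
  unfolding shifted_after_def
proof (intro ballI allI impI)
  fix k u assume "k \<in> procs n" "c + s < u"
  then show "u \<in> arrival_times (y k) \<longleftrightarrow> u + - s \<in> arrival_times (x k)"
    using shifted_afterD[OF assms, of k "u - s"] by simp
qed

lemma shifted_after_residual:
  assumes "regular_on (procs n) x" "0 \<le> c"
  shows "shifted_after n c s (residual_on (procs n) s x) x"
  using assms by (simp add: shifted_after_def residual_on_apply arrival_times_residual regular_onD)

lemma delivered_shift:
  assumes shift: "shifted_after n (a - \<delta>) s x y" and j_mem: "j \<in> {1..n}" and u_ge: "a \<le> u"
  shows "delivered n x \<delta> j u \<longleftrightarrow> delivered n y \<delta> j (u + s)"
proof -
  have "gossiping x \<delta> j' u \<longleftrightarrow> gossiping y \<delta> j' (u + s)" if j'_mem: "j' \<in> {1..n}" for j'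
  proof
    assume "gossiping x \<delta> j' u"
    then obtain v where "v \<in> arrival_times (x (Src j'))" "v \<le> u" "u < v + \<delta>"
      by (auto simp: gossiping_iff)
    with u_ge j'_mem shifted_afterD[OF shift, of "Src j'" v] show "gossiping y \<delta> j' (u + s)"
      unfolding gossiping_iff by (intro bexI[of _ "v + s"]) auto
  next
    assume "gossiping y \<delta> j' (u + s)"
    then obtain v where "v \<in> arrival_times (y (Src j'))" "v \<le> u + s" "u + s < v + \<delta>"
      by (auto simp: gossiping_iff)
    with u_ge j'_mem shifted_afterD[OF shift, of "Src j'" "v - s"] show "gossiping x \<delta> j' u"
      unfolding gossiping_iff by (intro bexI[of _ "v - s"]) auto
  qed
  with j_mem show ?thesis by (simp add: delivered_def)
qed

lemma src_ver_shift:
  assumes shift: "shifted_after n c s x y" and reg_x: "regular_on (procs n) x"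
    and reg_y: "regular_on (procs n) y"
    and "c \<le> a" "a \<le> u"
  shows "src_ver x u + src_ver y (a + s) = src_ver y (u + s) + src_ver x a"
proof -
  have "arrival_times (y Gen) \<inter> {a + s<..u + s} = (\<lambda>v. v + s) ` (arrival_times (x Gen) \<inter> {a<..u})"
  proof (intro set_eqI iffI)
    fix v assume "v \<in> arrival_times (y Gen) \<inter> {a + s<..u + s}"
    then show "v \<in> (\<lambda>v. v + s) ` (arrival_times (x Gen) \<inter> {a<..u})"
      using shifted_afterD[OF shift, of Gen "v - s"] \<open>c \<le> a\<close>
      by (intro image_eqI[of _ _ "v - s"]) auto
  next
    fix v assume "v \<in> (\<lambda>v. v + s) ` (arrival_times (x Gen) \<inter> {a<..u})"
    then show "v \<in> arrival_times (y Gen) \<inter> {a + s<..u + s}"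
      using shifted_afterD[OF shift, of Gen "v - s"] \<open>c \<le> a\<close> by auto
  qed
  then have "src_ver y (u + s) - src_ver y (a + s) = src_ver x u - src_ver x a"
    by (simp add: src_ver_eq arrivals_upto_diff_eq_card regular_onD[OF reg_x] regular_onD[OF reg_y]
        card_image)
  with src_ver_mono[OF reg_x \<open>a \<le> u\<close>] src_ver_mono[OF reg_y, of "a + s" "u + s"] \<open>a \<le> u\<close>
  show ?thesis by linarith
qed

lemma has_ver_shift:
  assumes shift: "shifted_after n (a - \<delta>) s x y" and delta_pos: "0 < \<delta>"
    and reg_x: "regular_on (procs n) x" and reg_y: "regular_on (procs n) y"
    and "has_ver n x \<delta> i t v" "src_ver x a < v"
  shows "has_ver n y \<delta> i (t + s) (v + src_ver y (a + s) - src_ver x a)"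
  using assms(5,6)
proof induction
  case (init i t)
  then show ?case by simp
next
  case (from_src i m t)
  let ?u = "arr (x (Src i)) m"
  have u_gt: "a < ?u" using from_src.prems by (rule src_ver_less_imp_less[OF reg_x])
  then have "?u + s \<in> arrival_times (y (Src i))"
    using shifted_afterD[OF shift, of "Src i" ?u] from_src.hyps delta_pos
    by (simp add: arrival_times_def)
  then have "has_ver n y \<delta> i (t + s) (src_ver y (?u + s))"
    using from_src.hyps by (intro has_ver_from_src_arrival) auto
  moreover have "src_ver x ?u + src_ver y (a + s) = src_ver y (?u + s) + src_ver x a"
    using u_gt delta_pos by (intro src_ver_shift[OF shift reg_x reg_y]) auto
  ultimately show ?case by simp
next
  case (from_gossip i j r v m t)
  let ?u = "arr (x (Gsp j i)) m"
  have "src_ver x a < src_ver x r"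
    using from_gossip.prems has_ver_le_src_ver[OF reg_x from_gossip.hyps(4)] by simp
  then have u_gt: "a < ?u"
    using src_ver_less_imp_less[OF reg_x] from_gossip.hyps(5) by fastforce
  then have "?u + s \<in> arrival_times (y (Gsp j i))"
    using shifted_afterD[OF shift, of "Gsp j i" ?u] from_gossip.hyps delta_pos
    by (simp add: arrival_times_def)
  moreover have "delivered n y \<delta> j (?u + s)"
    using delivered_shift[OF shift, of j ?u] from_gossip.hyps u_gt by simp
  ultimately show ?case
    using from_gossip by (intro has_ver_from_gossip_arrival[of i n j y \<delta> "r + s" _ "?u + s"]) auto
qed

lemma trunc_age_shift_le:
  assumes shift: "shifted_after n (a - \<delta>) s x y" and delta_pos: "0 < \<delta>"
    and reg_x: "regular_on (procs n) x" and reg_y: "regular_on (procs n) y" and "a \<le> t"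
  shows "trunc_age n \<delta> i (a + s) (t + s) y \<le> trunc_age n \<delta> i a t x"
proof -
  have "node_ver n x \<delta> i t + src_ver y (a + s) - src_ver x a \<le> node_ver n y \<delta> i (t + s)"
    if "src_ver x a < node_ver n x \<delta> i t"
    by (intro has_ver_le_node_ver[OF reg_y] has_ver_shift[OF shift delta_pos reg_x reg_y]
        has_ver_node_ver[OF reg_x] that)
  moreover have "src_ver x t + src_ver y (a + s) = src_ver y (t + s) + src_ver x a"
    using \<open>a \<le> t\<close> delta_pos by (intro src_ver_shift[OF shift reg_x reg_y]) auto
  ultimately show ?thesis unfolding trunc_age_eq by linarith
qed

lemma trunc_age_shift:
  assumes shift: "shifted_after n (a - \<delta>) s x y" and delta_pos: "0 < \<delta>"
    and reg_x: "regular_on (procs n) x" and reg_y: "regular_on (procs n) y" and "a \<le> t"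
  shows "trunc_age n \<delta> i (a + s) (t + s) y = trunc_age n \<delta> i a t x"
proof (rule antisym)
  have "shifted_after n (a + s - \<delta>) (- s) y x"
    using shifted_after_sym[OF shift] by (simp add: algebra_simps)
  from trunc_age_shift_le[OF this delta_pos reg_y reg_x, of "t + s"] \<open>a \<le> t\<close>
  show "trunc_age n \<delta> i a t x \<le> trunc_age n \<delta> i (a + s) (t + s) y" by simp
qed (rule trunc_age_shift_le[OF assms])

subsection \<open>Windows in which a node is served\<close>

text \<open>Ranges for the first arrivals in a window of length \<open>2\<delta>\<close> under which node j alone is contacted and then
  delivers to i: at the time of the tick of \<open>Gsp j i\<close>, contacts from before the window no longer matter,
  and j is still gossiping.\<close>

definition serving_range :: "real \<Rightarrow> nat \<Rightarrow> nat \<Rightarrow> proc \<Rightarrow> real set" where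
  "serving_range \<delta> i j k = (case k of
      Gen \<Rightarrow> UNIV
    | Src j' \<Rightarrow> if j' = j then {\<delta><..3/2 * \<delta>} else {2 * \<delta>..}
    | Gsp j' i' \<Rightarrow> if j' = j \<and> i' = i then {3/2 * \<delta><..7/4 * \<delta>} else UNIV)"

definition served :: "nat \<Rightarrow> real \<Rightarrow> nat \<Rightarrow> (proc \<Rightarrow> nat \<Rightarrow> real) \<Rightarrow> bool" where
  "served n \<delta> i x \<longleftrightarrow> (\<exists>j\<in>{1..n} - {i}. \<forall>k\<in>procs n. x k 0 \<in> serving_range \<delta> i j k)"

primrec unserved :: "nat \<Rightarrow> real \<Rightarrow> nat \<Rightarrow> nat \<Rightarrow> (proc \<Rightarrow> nat \<Rightarrow> real) \<Rightarrow> bool" where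
  "unserved n \<delta> i 0 x \<longleftrightarrow> True"
| "unserved n \<delta> i (Suc l) x \<longleftrightarrow> \<not> served n \<delta> i x \<and> unserved n \<delta> i l (residual_on (procs n) (2 * \<delta>) x)"

lemma min_mem_serving_range_iff:
  "0 < \<delta> \<Longrightarrow> min a (2 * \<delta>) \<in> serving_range \<delta> i j k \<longleftrightarrow> a \<in> serving_range \<delta> i j k"
  by (cases k) (auto simp: serving_range_def)

lemma served_imp_src_ver_le_node_ver:
  assumes reg: "regular_on (procs n) x" and delta_pos: "0 < \<delta>" and i_mem: "i \<in> {1..n}"
    and served: "served n \<delta> i (residual_on (procs n) b x)" and window_le: "b + 2 * \<delta> \<le> t"
  shows "src_ver x b \<le> node_ver n x \<delta> i t"
proof -
  from served obtain j where "j \<in> {1..n} - {i}"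
    and "\<forall>k\<in>procs n. residual_on (procs n) b x k 0 \<in> serving_range \<delta> i j k"
    unfolding served_def by blast
  then have j_mem: "j \<in> {1..n}" "j \<noteq> i"
    and first_arrival: "\<And>k. k \<in> procs n \<Longrightarrow> residual b (x k) 0 \<in> serving_range \<delta> i j k"
    by (auto simp: residual_on_apply)
  define c where "c = residual b (x (Src j)) 0 + b"
  define g where "g = residual b (x (Gsp j i)) 0 + b"
  have contact: "b + \<delta> < c" "c \<le> b + 3/2 * \<delta>" "c \<in> arrival_times (x (Src j))"
    using first_arrival[of "Src j"] j_mem next_arrival_mem by (auto simp: serving_range_def c_def)
  have gossip: "b + 3/2 * \<delta> < g" "g < b + 2 * \<delta>" "g \<in> arrival_times (x (Gsp j i))"
    using first_arrival[of "Gsp j i"] i_mem j_mem delta_pos next_arrival_mem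
    by (auto simp: serving_range_def g_def)
  have "\<not> gossiping x \<delta> j' g" if j'_mem: "j' \<in> {1..n}" "j' \<noteq> j" for j'
  proof
    assume "gossiping x \<delta> j' g"
    then obtain u where u_props: "u \<in> arrival_times (x (Src j'))" "u \<le> g" "g < u + \<delta>"
      by (auto simp: gossiping_iff)
    moreover have "b + 2 * \<delta> \<le> residual b (x (Src j')) 0 + b"
      using first_arrival[of "Src j'"] j'_mem by (auto simp: serving_range_def)
    moreover have "residual b (x (Src j')) 0 + b \<le> u"
      using u_props gossip delta_pos j'_mem by (intro next_arrival_le regular_onD[OF reg]) auto
    ultimately show False using gossip by simp
  qed
  moreover have "gossiping x \<delta> j g"
    unfolding gossiping_iff using contact gossip by (intro bexI[of _ c]) auto
  ultimately have "delivered n x \<delta> j g" by (auto simp: delivered_def)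
  then have "has_ver n x \<delta> i t (src_ver x c)"
    using i_mem j_mem contact gossip window_le has_ver_from_src_arrival[of j n c x c \<delta>]
    by (intro has_ver_from_gossip_arrival[of i n j x \<delta> c _ g]) auto
  then have "src_ver x c \<le> node_ver n x \<delta> i t" by (rule has_ver_le_node_ver[OF reg])
  moreover have "src_ver x b \<le> src_ver x c"
    using contact delta_pos by (intro src_ver_mono[OF reg]) simp
  ultimately show ?thesis by simp
qed

lemma not_unserved_imp_src_ver_le_node_ver:
  assumes reg: "regular_on (procs n) x" and delta_pos: "0 < \<delta>" and i_mem: "i \<in> {1..n}"
  shows "\<not> unserved n \<delta> i l (residual_on (procs n) b x) \<Longrightarrow> b + real l * (2 * \<delta>) \<le> t \<Longrightarrow>
    src_ver x b \<le> node_ver n x \<delta> i t"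
proof (induction l arbitrary: b)
  case (Suc l)
  show ?case
  proof (cases "served n \<delta> i (residual_on (procs n) b x)")
    case True
    have "0 \<le> real l * (2 * \<delta>)" using delta_pos by simp
    then have "b + 2 * \<delta> \<le> t" using Suc.prems(2) by (simp add: algebra_simps)
    then show ?thesis by (rule served_imp_src_ver_le_node_ver[OF reg delta_pos i_mem True])
  next
    case False
    then have "\<not> unserved n \<delta> i l (residual_on (procs n) (2 * \<delta> + b) x)"
      using Suc.prems(1) delta_pos by (simp add: residual_on_residual_on[OF reg])
    then have "src_ver x (2 * \<delta> + b) \<le> node_ver n x \<delta> i t"
      using Suc.prems(2) by (intro Suc.IH) (auto simp: algebra_simps)
    moreover have "src_ver x b \<le> src_ver x (2 * \<delta> + b)"
      using delta_pos by (intro src_ver_mono[OF reg]) simp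
    ultimately show ?thesis by simp
  qed
qed simp

lemma trunc_age_le:
  assumes reg: "regular_on (procs n) x" and delta_pos: "0 < \<delta>" and i_mem: "i \<in> {1..n}"
    and a_le_b: "a \<le> b" and windows_le: "b + real l * (2 * \<delta>) \<le> t"
  shows "trunc_age n \<delta> i a t x \<le> trunc_age n \<delta> i b t x +
    real (src_ver x b - src_ver x a) * of_bool (unserved n \<delta> i l (residual_on (procs n) b x))"
proof (cases "unserved n \<delta> i l (residual_on (procs n) b x)")
  case True
  then show ?thesis
    using src_ver_mono[OF reg a_le_b] by (auto simp: trunc_age_eq)
next
  case False
  then show ?thesis
    using src_ver_mono[OF reg a_le_b]
      not_unserved_imp_src_ver_le_node_ver[OF reg delta_pos i_mem False windows_le]
    by (simp add: trunc_age_eq)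
qed

lemma unserved_cong:
  "(\<And>k. k \<noteq> Gen \<Longrightarrow> x k = y k) \<Longrightarrow> unserved n \<delta> i l x \<longleftrightarrow> unserved n \<delta> i l y"
proof (induction l arbitrary: x y)
  case (Suc l)
  have "x k 0 \<in> serving_range \<delta> i j k \<longleftrightarrow> y k 0 \<in> serving_range \<delta> i j k" for j k
    using Suc.prems by (cases "k = Gen") (auto simp: serving_range_def)
  then have "served n \<delta> i x = served n \<delta> i y" by (simp add: served_def)
  moreover have "unserved n \<delta> i l (residual_on (procs n) (2 * \<delta>) x) =
      unserved n \<delta> i l (residual_on (procs n) (2 * \<delta>) y)"
    using Suc.prems by (intro Suc.IH) (auto simp: residual_on_def restrict_def)
  ultimately show ?case by simp
qed simp

section \<open>Measurability of the age\<close>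

text \<open>Unlike in \<open>has_ver\<close>, the intermediate times are rational, which makes measurability evident.\<close>

primrec has_ver_hops ::
  "nat \<Rightarrow> real \<Rightarrow> nat \<Rightarrow> nat \<Rightarrow> real \<Rightarrow> nat \<Rightarrow> (proc \<Rightarrow> nat \<Rightarrow> real) \<Rightarrow> bool" where
  "has_ver_hops n \<delta> 0 i t v x \<longleftrightarrow> v = 0 \<or> (i \<in> {1..n} \<and>
     (\<exists>m. arr (x (Src i)) m \<le> t \<and> v = src_ver x (arr (x (Src i)) m)))"
| "has_ver_hops n \<delta> (Suc d) i t v x \<longleftrightarrow> has_ver_hops n \<delta> d i t v x \<or> (i \<in> {1..n} \<and>
     (\<exists>j\<in>{1..n} - {i}. \<exists>q::rat. \<exists>m. has_ver_hops n \<delta> d j (of_rat q) v x \<and>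
        of_rat q < arr (x (Gsp j i)) m \<and> arr (x (Gsp j i)) m \<le> t \<and>
        delivered n x \<delta> j (arr (x (Gsp j i)) m)))"

lemma has_ver_hops_mono:
  assumes "has_ver_hops n \<delta> d i s v x" "s \<le> t"
  shows "has_ver_hops n \<delta> d i t v x"
  using assms
proof (induction d)
  case 0
  then show ?case by (auto intro: order_trans)
next
  case (Suc d)
  then show ?case unfolding has_ver_hops.simps by (meson order_trans)
qed

lemma has_ver_imp_has_ver_hops:
  "has_ver n x \<delta> i t v \<Longrightarrow> \<exists>d. has_ver_hops n \<delta> d i t v x"
proof (induction rule: has_ver.induct)
  case (init i t)
  have "has_ver_hops n \<delta> 0 i t 0 x" by simp
  then show ?case ..
next
  case (from_src i m t)
  then have "has_ver_hops n \<delta> 0 i t (src_ver x (arr (x (Src i)) m)) x" by auto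
  then show ?case ..
next
  case (from_gossip i j s v m t)
  then obtain d where hops: "has_ver_hops n \<delta> d j s v x" by auto
  obtain q :: rat where q_between: "s < of_rat q" "of_rat q < arr (x (Gsp j i)) m"
    using of_rat_dense from_gossip.hyps(5) by blast
  have "has_ver_hops n \<delta> d j (of_rat q) v x"
    using q_between(1) by (intro has_ver_hops_mono[OF hops]) simp
  then have "has_ver_hops n \<delta> (Suc d) i t v x" using from_gossip.hyps q_between(2) by auto
  then show ?case ..
qed

lemma has_ver_hops_imp_has_ver: "has_ver_hops n \<delta> d i t v x \<Longrightarrow> has_ver n x \<delta> i t v"
proof (induction d arbitrary: i t)
  case 0
  then show ?case by (auto intro: has_ver.intros)
next
  case (Suc d)
  consider "has_ver_hops n \<delta> d i t v x"
    | j q m where "i \<in> {1..n}" "j \<in> {1..n}" "j \<noteq> i" "has_ver_hops n \<delta> d j (of_rat q) v x"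
        "of_rat q < arr (x (Gsp j i)) m" "arr (x (Gsp j i)) m \<le> t"
        "delivered n x \<delta> j (arr (x (Gsp j i)) m)"
    using Suc.prems unfolding has_ver_hops.simps by blast
  then show ?case
    by cases (auto intro: Suc.IH has_ver.from_gossip)
qed

lemma has_ver_iff_hops: "has_ver n x \<delta> i t v \<longleftrightarrow> (\<exists>d. has_ver_hops n \<delta> d i t v x)"
  using has_ver_imp_has_ver_hops has_ver_hops_imp_has_ver by blast

lemma delivered_cong:
  assumes "\<And>k. k \<in> procs n \<Longrightarrow> x k = y k" "j \<in> {1..n}"
  shows "delivered n x \<delta> j u \<longleftrightarrow> delivered n y \<delta> j u"
  using assms by (simp add: delivered_def gossiping_def)

lemma age_cong:
  assumes x_eq_y: "\<And>k. k \<in> procs n \<Longrightarrow> x k = y k"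
  shows "age n x \<delta> i t = age n y \<delta> i t"
proof -
  have src_ver_eq_y: "src_ver x = src_ver y"
    using x_eq_y[of Gen] by (simp add: src_ver_def[abs_def])
  have "has_ver_hops n \<delta> d i t v x \<longleftrightarrow> has_ver_hops n \<delta> d i t v y" for d i t v
  proof (induction d arbitrary: i t)
    case 0
    show ?case by (simp add: src_ver_eq_y x_eq_y cong: conj_cong)
  next
    case (Suc d)
    have "x (Gsp j i) = y (Gsp j i)" "delivered n x \<delta> j u \<longleftrightarrow> delivered n y \<delta> j u"
      if "i \<in> {1..n}" "j \<in> {1..n} - {i}" for j u
      using that x_eq_y[of "Gsp j i"] delivered_cong[of n x y j \<delta>] x_eq_y by auto
    then show ?case
      unfolding has_ver_hops.simps Suc.IH
      by (intro arg_cong2[where f = "(\<or>)"] conj_cong bex_cong refl) auto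
  qed
  then show ?thesis
    by (simp add: age_def node_ver_def has_ver_iff_hops src_ver_eq_y)
qed

abbreviation config_borel :: "nat \<Rightarrow> (proc \<Rightarrow> nat \<Rightarrow> real) measure" where
  "config_borel n \<equiv> family_borel (procs n)"

lemma measurable_src_ver [measurable (raw)]:
  assumes [measurable]: "f \<in> borel_measurable (config_borel n)"
  shows "(\<lambda>x. src_ver x (f x)) \<in> config_borel n \<rightarrow>\<^sub>M count_space UNIV"
  unfolding src_ver_eq by measurable

lemma measurable_gossiping [measurable (raw)]:
  assumes f_meas: "f \<in> borel_measurable (config_borel n)" and j_mem: "j \<in> {1..n}"
  shows "Measurable.pred (config_borel n) (\<lambda>x. gossiping x \<delta> j (f x))"
  unfolding gossiping_def not_less[symmetric]
  by (intro pred_intros_countable pred_intros_logic borel_measurable_pred_less borel_measurable_add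
      borel_measurable_const measurable_family_arr f_meas) (use j_mem in auto)

lemma measurable_delivered [measurable (raw)]:
  assumes f_meas: "f \<in> borel_measurable (config_borel n)" and j_mem: "j \<in> {1..n}"
  shows "Measurable.pred (config_borel n) (\<lambda>x. delivered n x \<delta> j (f x))"
  unfolding delivered_def
  by (intro pred_intros_logic pred_intros_finite measurable_gossiping f_meas j_mem) auto

lemma measurable_has_ver_hops [measurable]:
  "Measurable.pred (config_borel n) (has_ver_hops n \<delta> d i t v)"
proof (induction d arbitrary: i t)
  case 0
  show ?case
  proof (cases "i \<in> {1..n}")
    case True
    then have [measurable]: "Src i \<in> procs n" by simp
    show ?thesis using True by simp
  qed simp
next
  case (Suc d)
  note [measurable] = Suc.IH
  have [measurable]:
    "Measurable.pred (config_borel n) (\<lambda>x. \<exists>q::rat. \<exists>m. has_ver_hops n \<delta> d j (of_rat q) v x \<and>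
        of_rat q < arr (x (Gsp j i)) m \<and> arr (x (Gsp j i)) m \<le> t \<and>
        delivered n x \<delta> j (arr (x (Gsp j i)) m))" if "i \<in> {1..n}" "j \<in> {1..n} - {i}" for j
  proof -
    have [measurable]: "Gsp j i \<in> procs n" "j \<in> {1..n}" using that by auto
    show ?thesis by measurable
  qed
  show ?case
  proof (cases "i \<in> {1..n}")
    case True
    then show ?thesis
      unfolding has_ver_hops.simps
      by (intro pred_intros_logic pred_intros_finite) (auto intro: Suc.IH simp del: ex_simps)
  next
    case False
    then show ?thesis using Suc.IH by simp
  qed
qed

lemma measurable_age [measurable]: "(\<lambda>x. age n x \<delta> i t) \<in> borel_measurable (config_borel n)"
proof -
  have [measurable]: "(\<lambda>x. node_ver n x \<delta> i t) \<in> config_borel n \<rightarrow>\<^sub>M count_space UNIV"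
    unfolding node_ver_def has_ver_iff_hops by (rule measurable_Greatest_nat) measurable
  show ?thesis unfolding age_def by measurable
qed

lemma measurable_trunc_age [measurable]: "trunc_age n \<delta> i a t \<in> borel_measurable (config_borel n)"
  unfolding trunc_age_def[abs_def] by measurable

lemma sets_serving_range [measurable]: "serving_range \<delta> i j k \<in> sets borel"
  by (cases k) (auto simp: serving_range_def)

lemma measurable_served [measurable]: "Measurable.pred (config_borel n) (served n \<delta> i)"
  unfolding served_def[abs_def]
  by (intro pred_intros_finite pred_sets2[OF sets_serving_range] measurable_family_nth) auto

lemma measurable_unserved [measurable]: "Measurable.pred (config_borel n) (unserved n \<delta> i l)"
  by (induction l) (simp_all add: measurable_compose[OF measurable_residual_on])

section \<open>Probability that a node is served in a window\<close>

lemma single_contact_prob_ge: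
  fixes y :: real
  assumes y_nonneg: "0 \<le> y" and n_ge: "2 \<le> n"
  shows "y / 4 * exp (- (2 * y)) \<le> (real n - 1) *
    ((exp (- (y / real n)) - exp (- (3/2 * (y / real n)))) * exp (- (2 * (y / real n))) ^ (n - 1))"
proof -
  define u where "u = y / real n"
  have u_props: "0 \<le> u" "real n * u = y" and half_n_le: "real n / 2 \<le> real n - 1"
    using y_nonneg n_ge by (auto simp: u_def)
  have power: "exp (- (2 * u)) ^ (n - 1) = exp ((real n - 1) * (- (2 * u)))"
    using n_ge by (subst exp_of_nat_mult[symmetric]) (simp add: of_nat_diff)
  have "y / 4 * exp (- (2 * y)) \<le>
      (real n - 1) * (u / 2) * exp (- (3/2 * u) + (real n - 1) * (- (2 * u)))"
  proof (rule mult_mono)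
    show "y / 4 \<le> (real n - 1) * (u / 2)"
      using mult_right_mono[OF half_n_le, of "u / 2"] u_props by simp
    show "exp (- (2 * y)) \<le> exp (- (3/2 * u) + (real n - 1) * (- (2 * u)))"
      using u_props by (simp add: algebra_simps)
  qed (use half_n_le u_props in auto)
  also have "\<dots> = (real n - 1) * (((3/2 * u - u) * exp (- (3/2 * u))) * exp (- (2 * u)) ^ (n - 1))"
    unfolding power exp_add by simp
  also have "\<dots> \<le> (real n - 1) * ((exp (- u) - exp (- (3/2 * u))) * exp (- (2 * u)) ^ (n - 1))"
    using n_ge by (intro mult_left_mono mult_right_mono exp_minus_diff_ge) auto
  finally show ?thesis unfolding u_def .
qed

locale gossip_net =
  fixes n :: nat and lam_e lam B \<delta> :: real
  assumes n_ge: "2 \<le> n" and lam_e_pos: "0 < lam_e" and lam_pos: "0 < lam" and B_pos: "0 < B"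
    and delta_pos: "0 < \<delta>"
begin

sublocale poisson_family "procs n" "rate n lam_e lam B"
  using n_ge lam_e_pos lam_pos B_pos by unfold_locales (auto simp: rate_def split: proc.split)

definition served_prob :: "nat \<Rightarrow> real" where
  "served_prob i = P.prob {x \<in> space law. served n \<delta> i x}"

lemma served_prob_le_1: "served_prob i \<le> 1"
  by (simp add: served_prob_def)

lemma prob_serving_range:
  assumes i_mem: "i \<in> {1..n}" and j_mem: "j \<in> {1..n} - {i}"
  shows "P.prob {x \<in> space law. \<forall>k\<in>procs n. x k 0 \<in> serving_range \<delta> i j k} =
    (exp (- (B / (real n - 1)) * (3/2 * \<delta>)) - exp (- (B / (real n - 1)) * (7/4 * \<delta>))) *
    ((exp (- (lam / real n) * \<delta>) - exp (- (lam / real n) * (3/2 * \<delta>))) *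
     exp (- (lam / real n) * (2 * \<delta>)) ^ (n - 1))"
proof -
  define f where
    "f k = measure (exponential_measure (rate n lam_e lam B k)) (serving_range \<delta> i j k)" for k
  have f_eq_1: "f k = 1" if "serving_range \<delta> i j k = UNIV" for k
    unfolding f_def that
    using prob_space.prob_space[OF prob_space_exponential_measure[OF rate_pos[of k]]] by simp
  have gossip_prob: "f (Gsp j i) =
      exp (- (B / (real n - 1)) * (3/2 * \<delta>)) - exp (- (B / (real n - 1)) * (7/4 * \<delta>))"
    using measure_exponential_interval[OF rate_pos[of "Gsp j i"], of "3/2 * \<delta>" "7/4 * \<delta>"] delta_pos
    by (simp add: f_def serving_range_def rate_def)
  have contact_prob: "f (Src j) = exp (- (lam / real n) * \<delta>) - exp (- (lam / real n) * (3/2 * \<delta>))"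
    using measure_exponential_interval[OF rate_pos[of "Src j"], of \<delta> "3/2 * \<delta>"] delta_pos
    by (simp add: f_def serving_range_def rate_def)
  have void_prob: "f (Src j') = exp (- (lam / real n) * (2 * \<delta>))" if "j' \<noteq> j" for j'
    using measure_exponential_atLeast[OF rate_pos[of "Src j'"], of "2 * \<delta>"] delta_pos that
    by (simp add: f_def serving_range_def rate_def)
  have "P.prob {x \<in> space law. \<forall>k\<in>procs n. x k 0 \<in> serving_range \<delta> i j k} = (\<Prod>k\<in>procs n. f k)"
    unfolding f_def by (rule prob_first_arrivals) measurable
  also have "\<dots> = (\<Prod>k\<in>insert (Gsp j i) (Src ` {1..n}). f k)"
    using i_mem j_mem
    by (intro prod.mono_neutral_right ballI f_eq_1 finite_procs)
      (auto simp: procs_def serving_range_def split: if_splits)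
  also have "\<dots> = f (Gsp j i) * (\<Prod>j'\<in>{1..n}. f (Src j'))"
    by (subst prod.insert) (auto simp: prod.reindex inj_on_def)
  also have "(\<Prod>j'\<in>{1..n}. f (Src j')) = f (Src j) * (\<Prod>j'\<in>{1..n} - {j}. f (Src j'))"
    using j_mem by (intro prod.remove) auto
  also have "(\<Prod>j'\<in>{1..n} - {j}. f (Src j')) = exp (- (lam / real n) * (2 * \<delta>)) ^ (n - 1)"
    using j_mem by (simp add: void_prob)
  finally show ?thesis unfolding gossip_prob contact_prob .
qed

lemma served_prob_eq:
  assumes i_mem: "i \<in> {1..n}"
  shows "served_prob i = (real n - 1) *
    ((exp (- (B / (real n - 1)) * (3/2 * \<delta>)) - exp (- (B / (real n - 1)) * (7/4 * \<delta>))) *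
     ((exp (- (lam / real n) * \<delta>) - exp (- (lam / real n) * (3/2 * \<delta>))) *
      exp (- (lam / real n) * (2 * \<delta>)) ^ (n - 1)))"
proof -
  define S where "S j = {x \<in> space law. \<forall>k\<in>procs n. x k 0 \<in> serving_range \<delta> i j k}" for j
  have "disjoint_family_on S ({1..n} - {i})"
    unfolding disjoint_family_on_def
  proof safe
    fix j j' x assume j_mem: "j \<in> {1..n}" "j' \<in> {1..n}" "j \<noteq> j'" and x_mem: "x \<in> S j" "x \<in> S j'"
    have "x (Src j) 0 \<in> serving_range \<delta> i j (Src j)" "x (Src j) 0 \<in> serving_range \<delta> i j' (Src j)"
      using x_mem j_mem(1) by (auto simp: S_def)
    then show "x \<in> {}" using j_mem delta_pos by (auto simp: serving_range_def)
  qed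
  moreover have "S j \<in> P.events" for j
  proof -
    have "Measurable.pred (config_borel n) (\<lambda>x. \<forall>k\<in>procs n. x k 0 \<in> serving_range \<delta> i j k)"
      by (intro pred_intros_finite pred_sets2[OF sets_serving_range] measurable_family_nth) auto
    then show ?thesis
      unfolding S_def by (simp add: measurable_cong_sets[OF sets_law refl] pred_def)
  qed
  ultimately have "P.prob (\<Union>j\<in>{1..n} - {i}. S j) = (\<Sum>j\<in>{1..n} - {i}. P.prob (S j))"
    by (intro P.finite_measure_finite_Union) auto
  moreover have "{x \<in> space law. served n \<delta> i x} = (\<Union>j\<in>{1..n} - {i}. S j)"
    by (auto simp: served_def S_def)
  moreover have "card ({1..n} - {i}) = n - 1" using i_mem by (simp add: card_Diff_singleton)
  ultimately show ?thesis
    using prob_serving_range[OF i_mem] n_ge by (simp add: served_prob_def S_def of_nat_diff)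
qed

lemma served_prob_pos: "i \<in> {1..n} \<Longrightarrow> 0 < served_prob i"
  unfolding served_prob_eq using n_ge lam_pos B_pos delta_pos
  by (intro mult_pos_pos) (auto simp: field_simps)

lemma served_prob_ge:
  assumes i_mem: "i \<in> {1..n}" and B_eq: "B = real n * lam"
  shows "(lam * \<delta>)\<^sup>2 / 16 * exp (- (11/2) * (lam * \<delta>)) \<le> served_prob i"
proof -
  define y where "y = lam * \<delta>"
  define b where "b = B / (real n - 1) * \<delta>"
  have "0 < y" using lam_pos delta_pos by (simp add: y_def)
  have "b = y * (real n / (real n - 1))" by (simp add: b_def B_eq y_def)
  moreover have "1 \<le> real n / (real n - 1)" "real n / (real n - 1) \<le> 2"
    using n_ge by (auto simp: field_simps)
  ultimately have b_bounds: "y \<le> b" "b \<le> 2 * y"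
    using mult_left_mono[of 1 "real n / (real n - 1)" y]
      mult_left_mono[of "real n / (real n - 1)" 2 y] \<open>0 < y\<close>
    by auto
  have "y / 4 * exp (- (7/2 * y)) \<le> (7/4 * b - 3/2 * b) * exp (- (7/4 * b))"
    using b_bounds \<open>0 < y\<close> by (intro mult_mono) auto
  also have "\<dots> \<le> exp (- (3/2 * b)) - exp (- (7/4 * b))"
    by (rule exp_minus_diff_ge)
  finally have gossip_prob_ge: "y / 4 * exp (- (7/2 * y)) \<le> exp (- (3/2 * b)) - exp (- (7/4 * b))" .
  have "y\<^sup>2 / 16 * exp (- (11/2) * y) = (y / 4 * exp (- (7/2 * y))) * (y / 4 * exp (- (2 * y)))"
    by (simp add: power2_eq_square flip: exp_add)
  also have "\<dots> \<le> (exp (- (3/2 * b)) - exp (- (7/4 * b))) * ((real n - 1) *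
      ((exp (- (y / real n)) - exp (- (3/2 * (y / real n)))) * exp (- (2 * (y / real n))) ^ (n - 1)))"
    using \<open>0 < y\<close> b_bounds n_ge by (intro mult_mono gossip_prob_ge single_contact_prob_ge) auto
  also have "\<dots> = served_prob i"
    unfolding served_prob_eq[OF i_mem] by (simp add: b_def y_def mult_ac)
  finally show ?thesis unfolding y_def .
qed

lemma prob_served_residual:
  assumes H_sets: "H \<in> sets (config_borel n)"
  shows "P.prob {x \<in> space law. served n \<delta> i x \<and> residual_on (procs n) (2 * \<delta>) x \<in> H} =
    served_prob i * P.prob H"
proof -
  define E where "E = {u \<in> space (PiM (procs n) (\<lambda>_. borel)).
    \<exists>j\<in>{1..n} - {i}. \<forall>k\<in>procs n. u k \<in> serving_range \<delta> i j k}"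
  have "Measurable.pred (PiM (procs n) (\<lambda>_. borel))
      (\<lambda>u. \<exists>j\<in>{1..n} - {i}. \<forall>k\<in>procs n. u k \<in> serving_range \<delta> i j k)"
    by (intro pred_intros_finite pred_sets2[OF sets_serving_range] measurable_component_singleton)
      auto
  then have "E \<in> sets (PiM (procs n) (\<lambda>_. borel))" unfolding E_def pred_def .
  from prob_min_first_residual_on[OF _ this H_sets, of "2 * \<delta>"] delta_pos
  have "P.prob {x \<in> space law. (\<lambda>k\<in>procs n. min (x k 0) (2 * \<delta>)) \<in> E \<and>
      residual_on (procs n) (2 * \<delta>) x \<in> H} =
      P.prob {x \<in> space law. (\<lambda>k\<in>procs n. min (x k 0) (2 * \<delta>)) \<in> E} * P.prob H" by simp
  moreover have "(\<lambda>k\<in>procs n. min (x k 0) (2 * \<delta>)) \<in> E \<longleftrightarrow> served n \<delta> i x" for x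
    by (simp add: E_def served_def min_mem_serving_range_iff[OF delta_pos] space_PiM)
  ultimately show ?thesis by (simp add: served_prob_def)
qed

lemma prob_unserved: "P.prob {x \<in> space law. unserved n \<delta> i l x} = (1 - served_prob i) ^ l"
proof (induction l)
  case 0
  show ?case using P.prob_space by simp
next
  case (Suc l)
  define F where "F = {x \<in> space law. unserved n \<delta> i l x}"
  let ?restart = "residual_on (procs n) (2 * \<delta>)"
  have F_sets [measurable]: "F \<in> sets (config_borel n)"
    unfolding F_def sets_law[symmetric] by measurable
  have unserved_Suc: "{x \<in> space law. unserved n \<delta> i (Suc l) x} =
      {x \<in> space law. ?restart x \<in> F} - {x \<in> space law. served n \<delta> i x \<and> ?restart x \<in> F}"
    by (auto simp: F_def space_law residual_on_def)
  have "P.prob {x \<in> space law. unserved n \<delta> i (Suc l) x} = P.prob {x \<in> space law. ?restart x \<in> F} -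
      P.prob {x \<in> space law. served n \<delta> i x \<and> ?restart x \<in> F}"
    unfolding unserved_Suc by (intro P.finite_measure_Diff) (measurable, auto)
  also have "P.prob {x \<in> space law. ?restart x \<in> F} = P.prob F"
    by (rule prob_residual_on[OF _ F_sets]) (use delta_pos in simp)
  also have "P.prob {x \<in> space law. served n \<delta> i x \<and> ?restart x \<in> F} = served_prob i * P.prob F"
    by (rule prob_served_residual[OF F_sets])
  also have "P.prob F = (1 - served_prob i) ^ l" unfolding F_def by (rule Suc.IH)
  finally show ?case by (simp add: algebra_simps)
qed

section \<open>The mean age\<close>

lemma measurable_src_ver_law [measurable]: "(\<lambda>x. src_ver x t) \<in> law \<rightarrow>\<^sub>M count_space UNIV"
  unfolding measurable_cong_sets[OF sets_law refl] by measurable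

lemma nn_integral_src_ver_increment_unserved:
  assumes a_le_b: "0 \<le> a" "a \<le> b"
  shows "(\<integral>\<^sup>+x. of_nat (src_ver x b - src_ver x a) *
      of_bool (unserved n \<delta> i l (residual_on (procs n) b x)) \<partial>law) =
    mean_arrivals lam_e (b - a) * ennreal ((1 - served_prob i) ^ l)"
proof -
  define N where "N z = (of_nat (arrivals_upto z b - arrivals_upto z a) :: ennreal)" for z
  define F where "F x = (of_bool (unserved n \<delta> i l x) :: ennreal)" for x
  have [measurable]: "N \<in> borel_measurable seq_borel"
    and [measurable]: "F \<in> borel_measurable (config_borel n)"
    unfolding N_def F_def by measurable
  have "F (residual_on (procs n) b (x(Gen := z))) = F (residual_on (procs n) b x)" for x z
    unfolding F_def
    by (intro arg_cong[where f = of_bool] unserved_cong) (simp add: residual_on_def restrict_def)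
  then have "(\<integral>\<^sup>+x. N (x Gen) * F (residual_on (procs n) b x) \<partial>law) =
      (\<integral>\<^sup>+z. N z \<partial>exponential_seq (rate n lam_e lam B Gen)) * (\<integral>\<^sup>+x. F (residual_on (procs n) b x) \<partial>law)"
    by (intro nn_integral_component_mult finite_index) (simp, measurable)
  also have "(\<integral>\<^sup>+z. N z \<partial>exponential_seq (rate n lam_e lam B Gen)) = mean_arrivals lam_e (b - a)"
    unfolding N_def using nn_integral_arrivals_increment[OF lam_e_pos a_le_b]
    by (simp add: rate_def)
  also have "(\<integral>\<^sup>+x. F (residual_on (procs n) b x) \<partial>law) = (\<integral>\<^sup>+x. F x \<partial>law)"
    using a_le_b by (intro nn_integral_residual_on) auto
  also have "\<dots> = (\<integral>\<^sup>+x. indicator {x \<in> space law. unserved n \<delta> i l x} x \<partial>law)"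
    by (intro nn_integral_cong) (auto simp: F_def indicator_def)
  also have "\<dots> = emeasure law {x \<in> space law. unserved n \<delta> i l x}"
    by (rule nn_integral_indicator) measurable
  finally show ?thesis
    by (simp add: P.emeasure_eq_measure prob_unserved N_def F_def src_ver_eq)
qed

definition mean_trunc_age :: "nat \<Rightarrow> real \<Rightarrow> real \<Rightarrow> ennreal" where
  "mean_trunc_age i a t = (\<integral>\<^sup>+x. ennreal (trunc_age n \<delta> i a t x) \<partial>law)"

lemma mean_trunc_age_0: "mean_trunc_age i 0 t = (\<integral>\<^sup>+x. ennreal (age n x \<delta> i t) \<partial>law)"
  unfolding mean_trunc_age_def using AE_regular_on
  by (intro nn_integral_cong_AE) (auto simp: trunc_age_0 elim!: eventually_mono)

lemma mean_trunc_age_shift: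
  assumes "\<delta> \<le> a" "a \<le> t" "0 \<le> s"
  shows "mean_trunc_age i (a + s) (t + s) = mean_trunc_age i a t"
proof -
  have "trunc_age n \<delta> i (a + s) (t + s) x = trunc_age n \<delta> i a t (residual_on (procs n) s x)"
    if reg: "regular_on (procs n) x" for x
    using assms
    by (intro trunc_age_shift[OF shifted_after_residual[OF reg] delta_pos
          regular_on_residual_on[OF reg] reg]) auto
  then have "mean_trunc_age i (a + s) (t + s) =
      (\<integral>\<^sup>+x. ennreal (trunc_age n \<delta> i a t (residual_on (procs n) s x)) \<partial>law)"
    unfolding mean_trunc_age_def using AE_regular_on
    by (intro nn_integral_cong_AE) (auto elim!: eventually_mono)
  also have "\<dots> = mean_trunc_age i a t"
    unfolding mean_trunc_age_def using assms by (intro nn_integral_residual_on) auto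
  finally show ?thesis .
qed

lemma mean_trunc_age_antimono: "a \<le> b \<Longrightarrow> mean_trunc_age i b t \<le> mean_trunc_age i a t"
  unfolding mean_trunc_age_def using AE_regular_on
  by (intro nn_integral_mono_AE)
    (auto intro!: ennreal_leI trunc_age_antimono elim!: eventually_mono)

lemma mean_trunc_age_mono:
  assumes "0 \<le> y" "y \<le> y'"
  shows "mean_trunc_age i \<delta> (\<delta> + y) \<le> mean_trunc_age i \<delta> (\<delta> + y')"
proof -
  have "mean_trunc_age i \<delta> (\<delta> + y) = mean_trunc_age i (\<delta> + (y' - y)) (\<delta> + y + (y' - y))"
    using assms delta_pos by (intro mean_trunc_age_shift[symmetric]) auto
  also have "\<dots> \<le> mean_trunc_age i \<delta> (\<delta> + y')"
    using assms by (simp add: mean_trunc_age_antimono)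
  finally show ?thesis .
qed

lemma mean_trunc_age_le:
  assumes i_mem: "i \<in> {1..n}" and a_le_b: "0 \<le> a" "a \<le> b" and windows_le: "b + real l * (2 * \<delta>) \<le> t"
  shows "mean_trunc_age i a t \<le>
    mean_trunc_age i b t + mean_arrivals lam_e (b - a) * ennreal ((1 - served_prob i) ^ l)"
proof -
  let ?N = "\<lambda>x. src_ver x b - src_ver x a"
    and ?unserved = "\<lambda>x. unserved n \<delta> i l (residual_on (procs n) b x)"
  have "0 \<le> real l * (2 * \<delta>)" using delta_pos by simp
  with windows_le have b_le_t: "b \<le> t" by linarith
  have "AE x in law. ennreal (trunc_age n \<delta> i a t x) \<le>
      ennreal (trunc_age n \<delta> i b t x) + of_nat (?N x) * of_bool (?unserved x)"
    using AE_regular_on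
  proof eventually_elim
    case (elim x)
    have "ennreal (trunc_age n \<delta> i a t x) \<le>
        ennreal (trunc_age n \<delta> i b t x + real (?N x) * of_bool (?unserved x))"
      by (intro ennreal_leI trunc_age_le[OF elim delta_pos i_mem a_le_b(2) windows_le])
    also have "\<dots> = ennreal (trunc_age n \<delta> i b t x) + of_nat (?N x) * of_bool (?unserved x)"
      using trunc_age_nonneg[OF elim b_le_t]
      by (cases "?unserved x") (simp_all add: ennreal_of_nat_eq_real_of_nat)
    finally show ?case .
  qed
  then have "mean_trunc_age i a t \<le>
      (\<integral>\<^sup>+x. ennreal (trunc_age n \<delta> i b t x) + of_nat (?N x) * of_bool (?unserved x) \<partial>law)"
    unfolding mean_trunc_age_def by (rule nn_integral_mono_AE)
  also have "\<dots> = mean_trunc_age i b t + (\<integral>\<^sup>+x. of_nat (?N x) * of_bool (?unserved x) \<partial>law)"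
    unfolding mean_trunc_age_def by (rule nn_integral_add) measurable
  finally show ?thesis unfolding nn_integral_src_ver_increment_unserved[OF a_le_b] .
qed

lemma mean_trunc_age_windows_le:
  assumes i_mem: "i \<in> {1..n}"
  shows "mean_trunc_age i \<delta> (\<delta> + real l * (2 * \<delta>)) \<le>
    mean_arrivals lam_e (2 * \<delta>) * ennreal (\<Sum>m<l. (1 - served_prob i) ^ m)"
proof (induction l)
  case 0
  have "mean_trunc_age i \<delta> \<delta> = (\<integral>\<^sup>+x. 0 \<partial>law)"
    unfolding mean_trunc_age_def
    by (intro nn_integral_cong) (simp add: trunc_age_def ennreal_eq_0_iff)
  then show ?case by simp
next
  case (Suc l)
  let ?c = "mean_arrivals lam_e (2 * \<delta>)" and ?q = "1 - served_prob i"
  define t where "t = \<delta> + real l * (2 * \<delta>)"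
  have t_props: "\<delta> + real (Suc l) * (2 * \<delta>) = t + 2 * \<delta>" "\<delta> \<le> t"
    using delta_pos by (simp_all add: t_def algebra_simps)
  have "mean_trunc_age i \<delta> (t + 2 * \<delta>) \<le>
      mean_trunc_age i (\<delta> + 2 * \<delta>) (t + 2 * \<delta>) + ?c * ennreal (?q ^ l)"
    using mean_trunc_age_le[OF i_mem, of \<delta> "\<delta> + 2 * \<delta>" l "t + 2 * \<delta>"] delta_pos by (simp add: t_def)
  also have "mean_trunc_age i (\<delta> + 2 * \<delta>) (t + 2 * \<delta>) = mean_trunc_age i \<delta> t"
    using delta_pos t_props by (intro mean_trunc_age_shift) auto
  also have "mean_trunc_age i \<delta> t + ?c * ennreal (?q ^ l) \<le>
      ?c * ennreal (\<Sum>m<l. ?q ^ m) + ?c * ennreal (?q ^ l)"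
    unfolding t_def by (intro add_right_mono Suc)
  also have "\<dots> = ?c * ennreal (\<Sum>m<Suc l. ?q ^ m)"
    using served_prob_le_1 by (simp add: sum_nonneg flip: distrib_left)
  finally show ?case unfolding t_props .
qed

lemma mean_trunc_age_bounded:
  assumes i_mem: "i \<in> {1..n}" and y_nonneg: "0 \<le> y"
  shows "mean_trunc_age i \<delta> (\<delta> + y) \<le> mean_arrivals lam_e (2 * \<delta>) * ennreal (1 / served_prob i)"
proof -
  obtain l :: nat where "y / (2 * \<delta>) \<le> real l" using real_arch_simple by blast
  then have "y \<le> real l * (2 * \<delta>)" using delta_pos by (simp add: field_simps)
  then have "mean_trunc_age i \<delta> (\<delta> + y) \<le> mean_trunc_age i \<delta> (\<delta> + real l * (2 * \<delta>))"
    by (rule mean_trunc_age_mono[OF y_nonneg])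
  also have "\<dots> \<le> mean_arrivals lam_e (2 * \<delta>) * ennreal (\<Sum>m<l. (1 - served_prob i) ^ m)"
    by (rule mean_trunc_age_windows_le[OF i_mem])
  also have "\<dots> \<le> mean_arrivals lam_e (2 * \<delta>) * ennreal (1 / served_prob i)"
  proof (intro mult_left_mono ennreal_leI)
    have "(\<Sum>m<l. (1 - served_prob i) ^ m) = (1 - (1 - served_prob i) ^ l) / served_prob i"
      using served_prob_pos[OF i_mem] by (simp add: sum_gp_strict)
    also have "\<dots> \<le> 1 / served_prob i"
      using served_prob_pos[OF i_mem] served_prob_le_1[of i] by (intro divide_right_mono) auto
    finally show "(\<Sum>m<l. (1 - served_prob i) ^ m) \<le> 1 / served_prob i" .
  qed simp
  finally show ?thesis .
qed

lemma truncation_error_tendsto_0: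
  assumes i_mem: "i \<in> {1..n}"
  shows "((\<lambda>t. mean_arrivals lam_e \<delta> *
      ennreal ((1 - served_prob i) ^ nat \<lfloor>(t - \<delta>) / (2 * \<delta>)\<rfloor>)) \<longlongrightarrow> 0) at_top"
proof -
  have "filterlim (\<lambda>t. nat \<lfloor>(t - \<delta>) / (2 * \<delta>)\<rfloor>) sequentially at_top"
    using delta_pos by real_asymp
  moreover have "(\<lambda>m. (1 - served_prob i) ^ m) \<longlonglongrightarrow> 0"
    using served_prob_pos[OF i_mem] served_prob_le_1[of i] by (intro LIMSEQ_realpow_zero) auto
  ultimately have "((\<lambda>t. (1 - served_prob i) ^ nat \<lfloor>(t - \<delta>) / (2 * \<delta>)\<rfloor>) \<longlongrightarrow> 0) at_top"
    by (rule filterlim_compose[rotated])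
  then have "((\<lambda>t. ennreal ((1 - served_prob i) ^ nat \<lfloor>(t - \<delta>) / (2 * \<delta>)\<rfloor>)) \<longlongrightarrow> ennreal 0) at_top"
    by (rule tendsto_ennrealI)
  from ennreal_tendsto_cmult[OF _ this, of "mean_arrivals lam_e \<delta>"] show ?thesis
    using mean_arrivals_finite[OF lam_e_pos, of \<delta>] delta_pos by simp
qed

lemma mean_age_tendsto:
  assumes i_mem: "i \<in> {1..n}"
  shows "((\<lambda>t. \<integral>\<^sup>+x. ennreal (age n x \<delta> i t) \<partial>law) \<longlongrightarrow>
      (SUP y\<in>{0..}. mean_trunc_age i \<delta> (\<delta> + y))) at_top"
    (is "(_ \<longlongrightarrow> ?L) at_top")
proof -
  have "filterlim (\<lambda>t. t - \<delta>) at_top at_top" by real_asymp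
  moreover have "((\<lambda>y. mean_trunc_age i \<delta> (\<delta> + y)) \<longlongrightarrow> ?L) at_top"
    by (intro mono_on_tendsto_SUP_at_top mono_onI mean_trunc_age_mono) auto
  ultimately have trunc_tendsto: "((\<lambda>t. mean_trunc_age i \<delta> (\<delta> + (t - \<delta>))) \<longlongrightarrow> ?L) at_top"
    by (rule filterlim_compose[rotated])
  let ?error = "\<lambda>t. mean_arrivals lam_e \<delta> * ennreal ((1 - served_prob i) ^ nat \<lfloor>(t - \<delta>) / (2 * \<delta>)\<rfloor>)"
  have "((\<lambda>t. mean_trunc_age i 0 t) \<longlongrightarrow> ?L) at_top"
  proof (rule tendsto_sandwich[OF _ _ trunc_tendsto])
    show "((\<lambda>t. mean_trunc_age i \<delta> (\<delta> + (t - \<delta>)) + ?error t) \<longlongrightarrow> ?L) at_top"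
      using tendsto_add[OF trunc_tendsto truncation_error_tendsto_0[OF i_mem]] by simp
    show "\<forall>\<^sub>F t in at_top. mean_trunc_age i \<delta> (\<delta> + (t - \<delta>)) \<le> mean_trunc_age i 0 t"
      using delta_pos by (intro always_eventually allI) (simp add: mean_trunc_age_antimono)
    show "\<forall>\<^sub>F t in at_top. mean_trunc_age i 0 t \<le> mean_trunc_age i \<delta> (\<delta> + (t - \<delta>)) + ?error t"
      using eventually_ge_at_top[of \<delta>]
    proof eventually_elim
      case (elim t)
      then have "real (nat \<lfloor>(t - \<delta>) / (2 * \<delta>)\<rfloor>) \<le> (t - \<delta>) / (2 * \<delta>)"
        using delta_pos by (simp add: of_nat_nat)
      then have "\<delta> + real (nat \<lfloor>(t - \<delta>) / (2 * \<delta>)\<rfloor>) * (2 * \<delta>) \<le> t"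
        using delta_pos by (simp add: field_simps)
      then show ?case using mean_trunc_age_le[OF i_mem, of 0 \<delta> _ t] delta_pos by simp
    qed
  qed
  then show ?thesis by (simp add: mean_trunc_age_0)
qed

lemma steady_state_mean_age:
  assumes i_mem: "i \<in> {1..n}"
  obtains a where "0 \<le> a" "a \<le> enn2real (mean_arrivals lam_e (2 * \<delta>)) / served_prob i"
    "((\<lambda>t. \<integral>\<^sup>+x. ennreal (age n x \<delta> i t) \<partial>law) \<longlongrightarrow> ennreal a) at_top"
proof -
  let ?L = "SUP y\<in>{0..}. mean_trunc_age i \<delta> (\<delta> + y)"
  have prob_pos: "0 < served_prob i" by (rule served_prob_pos[OF i_mem])
  have "?L \<le> mean_arrivals lam_e (2 * \<delta>) * ennreal (1 / served_prob i)"
    by (intro SUP_least mean_trunc_age_bounded i_mem) auto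
  also have "\<dots> = ennreal (enn2real (mean_arrivals lam_e (2 * \<delta>)) / served_prob i)"
    using prob_pos mean_arrivals_finite[OF lam_e_pos, of "2 * \<delta>"] delta_pos
    by (cases "mean_arrivals lam_e (2 * \<delta>)") (auto simp: divide_inverse simp flip: ennreal_mult)
  finally have limit_le: "?L \<le> ennreal (enn2real (mean_arrivals lam_e (2 * \<delta>)) / served_prob i)" .
  show ?thesis
  proof (rule that)
    show "enn2real ?L \<le> enn2real (mean_arrivals lam_e (2 * \<delta>)) / served_prob i"
      using prob_pos by (intro enn2real_leI limit_le) auto
    show "((\<lambda>t. \<integral>\<^sup>+x. ennreal (age n x \<delta> i t) \<partial>law) \<longlongrightarrow> ennreal (enn2real ?L)) at_top"
      using mean_age_tendsto[OF i_mem] limit_le by (simp add: le_less_trans)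
  qed simp
qed

end

lemma (in prob_space) nn_integral_age_gossip_model:
  assumes "gossip_model M n lam_e lam B X"
  shows "(\<integral>\<^sup>+\<omega>. ennreal (age n (\<lambda>k m. X k m \<omega>) \<delta> i t) \<partial>M) =
    (\<integral>\<^sup>+x. ennreal (age n x \<delta> i t) \<partial>PiM (procs n) (\<lambda>k. exponential_seq (rate n lam_e lam B k)))"
proof -
  let ?Y = "\<lambda>\<omega>. \<lambda>k\<in>procs n. \<lambda>m. X k m \<omega>"
  have "procs n \<noteq> {}" using procs_simps(1) by blast
  with assms have Y_meas: "?Y \<in> M \<rightarrow>\<^sub>M config_borel n"
    and distr_Y: "distr M (config_borel n) ?Y =
        PiM (procs n) (\<lambda>k. exponential_seq (rate n lam_e lam B k))"
    unfolding gossip_model_def by (intro distr_exponential_families; blast)+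
  have "(\<integral>\<^sup>+\<omega>. ennreal (age n (\<lambda>k m. X k m \<omega>) \<delta> i t) \<partial>M) = (\<integral>\<^sup>+\<omega>. ennreal (age n (?Y \<omega>) \<delta> i t) \<partial>M)"
    by (intro nn_integral_cong arg_cong[where f = ennreal] age_cong) simp
  also have "\<dots> = (\<integral>\<^sup>+x. ennreal (age n x \<delta> i t) \<partial>distr M (config_borel n) ?Y)"
    by (rule nn_integral_distr[symmetric, OF Y_meas]) measurable
  finally show ?thesis unfolding distr_Y .
qed

theorem theorem3:
  fixes M :: "'a measure"
    and X :: "nat \<Rightarrow> proc \<Rightarrow> nat \<Rightarrow> 'a \<Rightarrow> real"
    and lam_e lam delta :: real
  assumes "prob_space M"
    and "lam_e > 0" and "lam > 0" and "delta > 0"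
    and model: "\<And>n. n \<ge> 2 \<Longrightarrow> gossip_model M n lam_e lam (real n * lam) (X n)"
  shows "\<exists>C::real. \<forall>\<^sub>F n in sequentially. \<forall>i\<in>{1..n}. \<exists>a::real. a \<le> C \<and>
           ((\<lambda>t. \<integral>\<^sup>+ \<omega>. ennreal (age n (\<lambda>k m. X n k m \<omega>) delta i t) \<partial>M)
              \<longlongrightarrow> ennreal a) at_top"
proof -
  interpret model_space: prob_space M by fact
  define p where "p = (lam * delta)\<^sup>2 / 16 * exp (- (11/2) * (lam * delta))"
  have "0 < p" using assms by (simp add: p_def)
  have "\<exists>a\<le>enn2real (mean_arrivals lam_e (2 * delta)) / p.
      ((\<lambda>t. \<integral>\<^sup>+ \<omega>. ennreal (age n (\<lambda>k m. X n k m \<omega>) delta i t) \<partial>M) \<longlongrightarrow> ennreal a) at_top"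
    if n_ge: "2 \<le> n" and i_mem: "i \<in> {1..n}" for n i
  proof -
    interpret gossip_net n lam_e lam "real n * lam" delta
      using assms n_ge by unfold_locales auto
    obtain a where "0 \<le> a"
      and a_le: "a \<le> enn2real (mean_arrivals lam_e (2 * delta)) / served_prob i"
      and lim: "((\<lambda>t. \<integral>\<^sup>+x. ennreal (age n x delta i t) \<partial>law) \<longlongrightarrow> ennreal a) at_top"
      using i_mem by (rule steady_state_mean_age)
    have "p \<le> served_prob i" unfolding p_def using i_mem by (intro served_prob_ge) simp_all
    with \<open>0 < p\<close> have "enn2real (mean_arrivals lam_e (2 * delta)) / served_prob i \<le>
        enn2real (mean_arrivals lam_e (2 * delta)) / p"
      by (intro divide_left_mono) auto
    with a_le lim show ?thesis
      unfolding model_space.nn_integral_age_gossip_model[OF model[OF n_ge]]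
      by (intro exI[of _ a]) auto
  qed
  then show ?thesis
    by (intro exI[of _ "enn2real (mean_arrivals lam_e (2 * delta)) / p"]
        eventually_sequentiallyI[of 2]) auto
qed

end
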